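(* Let $\Lambda\subset[0,\infty)$ be an additive semigroup with $0\in\Lambda$, let $\omega$ be an admissible weight on $\Lambda$, let $d\in\mathbb{N}$, and let $\mathcal{A}$ be one of $M_d(\mathbb{C})$, $M_d(\mathbb{BC})$, $M_d(\mathbb{H})$. Then $\mathcal{D}(\Lambda,\omega,\mathcal{A})$ is inverse-closed in $\mathcal{D}(\Lambda,\mathcal{A})$: every $f\in\mathcal{D}(\Lambda,\omega,\mathcal{A})$ that is invertible in $\mathcal{D}(\Lambda,\mathcal{A})$ has its inverse in $\mathcal{D}(\Lambda,\omega,\mathcal{A})$.
   Context: $\mathcal{H}=\{s\in\mathbb C:\operatorname{Re}s\geq 0\}$. $M_d(\mathbb C)$: complex $d\times d$ matrices with operator norm. $M_d(\mathbb{BC})$: $d\times d$ matrices over the bicomplex numbers $\mathbb{BC}$ (real algebra spanned by $1,i,j,k$ with $i^2=j^2=-1$, $ij=ji=k$), written uniquely as $M_1\mathbf e_1+M_2\mathbf e_2$ with $\mathbf e_{1,2}=(1\pm k)/2$, $M_1,M_2$ complex matrices, operations componentwise, norm $\|M_1\|_{op}+\|M_2\|_{op}$. $M_d(\mathbb H)$: $d\times d$ quaternionic matrices with operator norm on $\mathbb H^{d\times 1}$. A weight on $\Lambda$ is $\omega:\Lambda\to[1,\infty)$ with $\omega(0)=1$, $\omega(\lambda_1+\lambda_2)\le\omega(\lambda_1)\omega(\lambda_2)$; admissible if $\lim_{n\to\infty}\omega(n\lambda)^{1/n}=1$ for all $\lambda$. $\mathcal D(\Lambda,\omega,\mathcal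 A)$ is the unital Banach algebra (pointwise product) of $f:\mathcal H\to\mathcal A$, $f(s)=\sum_{\lambda\in\Lambda}f_\lambda e^{-\lambda s}$ with $\sum_\lambda\|f_\lambda\|\omega(\lambda)<\infty$; $\mathcal D(\Lambda,\mathcal A)$ is the case $\omega\equiv1$. *)

theory Defs
  imports "HOL-Analysis.Analysis"
begin

section \<open>Semigroups of exponents and weights\<close>

definition exp_semigroup :: "real set \<Rightarrow> bool" where
  "exp_semigroup \<Lambda> \<longleftrightarrow> \<Lambda> \<subseteq> {0..} \<and> 0 \<in> \<Lambda> \<and> (\<forall>a\<in>\<Lambda>. \<forall>b\<in>\<Lambda>. a + b \<in> \<Lambda>)"

definition weight_on :: "real set \<Rightarrow> (real \<Rightarrow> real) \<Rightarrow> bool" where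
  "weight_on \<Lambda> \<omega> \<longleftrightarrow> (\<forall>x\<in>\<Lambda>. \<omega> x \<ge> 1) \<and> \<omega> 0 = 1 \<and>
     (\<forall>a\<in>\<Lambda>. \<forall>b\<in>\<Lambda>. \<omega> (a + b) \<le> \<omega> a * \<omega> b)"

definition admissible_weight :: "real set \<Rightarrow> (real \<Rightarrow> real) \<Rightarrow> bool" where
  "admissible_weight \<Lambda> \<omega> \<longleftrightarrow> weight_on \<Lambda> \<omega> \<and>
     (\<forall>x\<in>\<Lambda>. (\<lambda>n. root n (\<omega> (real n * x))) \<longlonglongrightarrow> 1)"

section \<open>Weighted algebras of generalized Dirichlet series (coefficient picture)\<close>

text \<open>An element of D(Lambda, omega, A) is represented by its coefficient family
  c :: real => A, supported on Lambda, with sum of nrm (c x) * omega x finite.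
  The product corresponds to the Cauchy (Dirichlet) convolution of coefficients.\<close>

definition Dset :: "('a \<Rightarrow> real) \<Rightarrow> real set \<Rightarrow> (real \<Rightarrow> real) \<Rightarrow> (real \<Rightarrow> 'a::zero) set" where
  "Dset nrm \<Lambda> \<omega> = {c. (\<forall>x. x \<notin> \<Lambda> \<longrightarrow> c x = 0) \<and> (\<lambda>x. nrm (c x) * \<omega> x) summable_on \<Lambda>}"

definition dconv :: "('a \<Rightarrow> 'a \<Rightarrow> 'a::{t2_space,comm_monoid_add}) \<Rightarrow> real set
    \<Rightarrow> (real \<Rightarrow> 'a) \<Rightarrow> (real \<Rightarrow> 'a) \<Rightarrow> real \<Rightarrow> 'a" where
  "dconv mul \<Lambda> c e = (\<lambda>\<nu>. \<Sum>\<^sub>\<infinity>(a, b)\<in>{(a, b). a \<in> \<Lambda> \<and> b \<in> \<Lambda> \<and> a + b = \<nu>}. mul (c a) (e b))"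

definition dunit :: "'a \<Rightarrow> real \<Rightarrow> 'a::zero" where
  "dunit one = (\<lambda>\<nu>. if \<nu> = 0 then one else 0)"

text \<open>D(Lambda,omega,A) is inverse-closed in D(Lambda,A): every element of the weighted
  algebra that has an inverse in the unweighted algebra has that inverse in the weighted one.\<close>

definition inverse_closed ::
  "('a \<Rightarrow> 'a \<Rightarrow> 'a::{t2_space,comm_monoid_add}) \<Rightarrow> 'a \<Rightarrow> ('a \<Rightarrow> real)
     \<Rightarrow> real set \<Rightarrow> (real \<Rightarrow> real) \<Rightarrow> bool" where
  "inverse_closed mul one nrm \<Lambda> \<omega> \<longleftrightarrow>
     (\<forall>c\<in>Dset nrm \<Lambda> \<omega>. \<forall>e\<in>Dset nrm \<Lambda> (\<lambda>_. 1).
        dconv mul \<Lambda> c e = dunit one \<and> dconv mul \<Lambda> e c = dunit one \<longrightarrow> e \<in> Dset nrm \<Lambda> \<omega>)"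

section \<open>The coefficient algebras\<close>

subsection \<open>M_d(C): complex d x d matrices, operator norm\<close>

definition cmat_norm :: "complex^'n^'n \<Rightarrow> real" where
  "cmat_norm A = onorm (\<lambda>x::complex^'n. A *v x)"

subsection \<open>M_d(BC): pairs (M1, M2) standing for M1 e1 + M2 e2\<close>

definition bcmat_mult :: "(complex^'n^'n) \<times> (complex^'n^'n) \<Rightarrow> (complex^'n^'n) \<times> (complex^'n^'n)
    \<Rightarrow> (complex^'n^'n) \<times> (complex^'n^'n)" where
  "bcmat_mult A B = (fst A ** fst B, snd A ** snd B)"

definition bcmat_one :: "(complex^'n^'n) \<times> (complex^'n^'n)" where
  "bcmat_one = (mat 1, mat 1)"

definition bcmat_norm :: "(complex^'n^'n) \<times> (complex^'n^'n) \<Rightarrow> real" where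
  "bcmat_norm A = cmat_norm (fst A) + cmat_norm (snd A)"

subsection \<open>M_d(H): quaternions as real^4 (coordinates w.r.t. 1, i, j, k) with Hamilton product\<close>

definition qmult :: "real^4 \<Rightarrow> real^4 \<Rightarrow> real^4" where
  "qmult p q = vector [
     p$1 * q$1 - p$2 * q$2 - p$3 * q$3 - p$4 * q$4,
     p$1 * q$2 + p$2 * q$1 + p$3 * q$4 - p$4 * q$3,
     p$1 * q$3 - p$2 * q$4 + p$3 * q$1 + p$4 * q$2,
     p$1 * q$4 + p$2 * q$3 - p$3 * q$2 + p$4 * q$1]"

definition qone :: "real^4" where
  "qone = vector [1, 0, 0, 0]"

definition hmat_mult :: "(real^4)^'n^'n \<Rightarrow> (real^4)^'n^'n \<Rightarrow> (real^4)^'n^'n" where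
  "hmat_mult A B = (\<chi> i j. \<Sum>k\<in>UNIV. qmult (A$i$k) (B$k$j))"

definition hmat_vec :: "(real^4)^'n^'n \<Rightarrow> (real^4)^'n \<Rightarrow> (real^4)^'n" where
  "hmat_vec A x = (\<chi> i. \<Sum>j\<in>UNIV. qmult (A$i$j) (x$j))"

definition hmat_one :: "(real^4)^'n^'n" where
  "hmat_one = (\<chi> i j. if i = j then qone else 0)"

text \<open>Operator norm on H^(d x 1); the norm of (real^4)^'n is the Euclidean one,
  i.e. sqrt of the sum of squared quaternion moduli.\<close>
definition hmat_norm :: "(real^4)^'n^'n \<Rightarrow> real" where
  "hmat_norm A = onorm (hmat_vec A)"

end

theory Submission
  imports Defs
begin

text \<open>
  Let c be \<omega>-summable with an inverse e that is only known to be summable. Cutting e off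
  to a finitely supported g gives c * g = \<delta> - r with r small in the unweighted norm and
  e * r = e - g, hence e = (\<Sum>k<N. g * r^k) + e * r^N. Admissibility of \<omega> allows
  us to replace \<omega> by an equivalent submultiplicative weight \<sigma> that is at most 2 on the
  finitely many exponents carrying almost all of the \<omega>-mass of r. Then r is also small
  in the \<sigma>-weighted norm, so the series \<Sum>k. g * r^k converges \<omega>-absolutely while
  e * r^N tends to 0, and e is \<omega>-summable.

  The three matrix algebras are finite dimensional with a bounded bilinear product, and
  their operator norms are equivalent to the Euclidean norm, so the abstract result
  applies to each of them.
\<close>

lemma has_sum_diff:
  fixes f g :: "'x \<Rightarrow> 'b::topological_ab_group_add"
  assumes "(f has_sum S) A" and "(g has_sum T) A"
  shows "((\<lambda>x. f x - g x) has_sum (S - T)) A"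
proof -
  have "((\<lambda>x. - g x) has_sum - T) A"
    using assms(2) by (simp add: has_sum_uminus)
  from has_sum_add[OF assms(1) this] show ?thesis
    by simp
qed

lemma has_sum_product_nonneg:
  fixes f :: "'x \<Rightarrow> real" and g :: "'y \<Rightarrow> real"
  assumes "\<And>x. x \<in> A \<Longrightarrow> 0 \<le> f x" and "\<And>y. y \<in> B \<Longrightarrow> 0 \<le> g y"
    and "(f has_sum S) A" and "(g has_sum T) B"
  shows "((\<lambda>(x, y). f x * g y) has_sum (S * T)) (A \<times> B)"
proof -
  have inner: "((\<lambda>y. f x * g y) has_sum f x * T) B" for x
    using has_sum_cmult_right[OF assms(4)] .
  have outer: "((\<lambda>x. f x * T) has_sum S * T) A"
    using has_sum_cmult_left[OF assms(3)] .
  have "(\<lambda>(x, y). f x * g y) summable_on Sigma A (\<lambda>_. B)"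
    by (rule summable_on_SigmaI[where g = "\<lambda>x. f x * T"])
       (use inner outer assms in \<open>auto simp: summable_on_def\<close>)
  then show ?thesis
    using has_sum_SigmaI[where f = "\<lambda>(x, y). f x * g y" and g = "\<lambda>x. f x * T"] inner outer
    by auto
qed

lemma sum_le_geometric_bound:
  fixes a :: "nat \<Rightarrow> real"
  assumes "\<And>k. a k \<le> M * q ^ k" and "0 \<le> M" and "0 \<le> q" and "q < 1"
  shows "(\<Sum>k<N. a k) \<le> M / (1 - q)"
proof -
  have "(\<Sum>k<N. a k) \<le> M * (\<Sum>k<N. q ^ k)"
    using assms(1) by (simp add: sum_distrib_left sum_mono)
  also have "\<dots> = M * (1 - q ^ N) / (1 - q)"
    using assms(4) by (simp add: sum_gp_strict)
  also have "\<dots> \<le> M / (1 - q)"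
    using assms(2-4) by (intro divide_right_mono) (auto simp: mult_left_le)
  finally show ?thesis .
qed

section \<open>Exponent semigroups\<close>

lemma exp_semigroup_zero: "exp_semigroup L \<Longrightarrow> 0 \<in> L"
  by (simp add: exp_semigroup_def)

lemma exp_semigroup_add: "exp_semigroup L \<Longrightarrow> a \<in> L \<Longrightarrow> b \<in> L \<Longrightarrow> a + b \<in> L"
  by (simp add: exp_semigroup_def)

lemma exp_semigroup_lincomb:
  assumes "exp_semigroup L" and "finite F" and "F \<subseteq> L"
  shows "(\<Sum>m\<in>F. real (n m) * m) \<in> L"
proof -
  have nat_mult: "real k * m \<in> L" if "m \<in> L" for k m
    by (induction k) (use assms(1) that in \<open>auto simp: exp_semigroup_zero exp_semigroup_add distrib_right\<close>)
  show ?thesis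
    using assms(2,3) by induction (auto simp: assms(1) exp_semigroup_zero exp_semigroup_add nat_mult)
qed

definition add_fiber :: "real set \<Rightarrow> real \<Rightarrow> (real \<times> real) set" where
  "add_fiber L v = {(a, b). a \<in> L \<and> b \<in> L \<and> a + b = v}"

definition add_fiber3 :: "real set \<Rightarrow> real \<Rightarrow> (real \<times> real \<times> real) set" where
  "add_fiber3 L v = {(x, y, z). x \<in> L \<and> y \<in> L \<and> z \<in> L \<and> x + y + z = v}"

lemma dconv_eq_infsum_add_fiber:
  "dconv mul L c e v = (\<Sum>\<^sub>\<infinity>(a, b)\<in>add_fiber L v. mul (c a) (e b))"
  by (simp add: dconv_def add_fiber_def)

lemma add_fiber_subset: "add_fiber L v \<subseteq> L \<times> L"
  by (auto simp: add_fiber_def)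

lemma add_fiber_empty: "exp_semigroup L \<Longrightarrow> v \<notin> L \<Longrightarrow> add_fiber L v = {}"
  by (auto simp: add_fiber_def exp_semigroup_add)

lemma
  fixes H :: "real \<times> real \<Rightarrow> 'b::banach"
  assumes L: "exp_semigroup L" and H: "H summable_on L \<times> L"
  shows summable_on_infsum_add_fiber: "(\<lambda>v. infsum H (add_fiber L v)) summable_on L"
    and infsum_infsum_add_fiber: "(\<Sum>\<^sub>\<infinity>v\<in>L. infsum H (add_fiber L v)) = infsum H (L \<times> L)"
proof -
  have summable: "(\<lambda>(v, p). H p) summable_on Sigma L (add_fiber L)"
    using H by (subst summable_on_reindex_bij_witness[where i = "\<lambda>(a, b). (a + b, (a, b))"
          and j = "\<lambda>(v, p). p" and T = "L \<times> L" and h = H])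
      (auto simp: add_fiber_def exp_semigroup_add L)
  show "(\<lambda>v. infsum H (add_fiber L v)) summable_on L"
    using summable_on_Sigma_banach[OF summable] by simp
  have "(\<Sum>\<^sub>\<infinity>(v, p)\<in>Sigma L (add_fiber L). H p) = infsum H (L \<times> L)"
    by (rule infsum_reindex_bij_witness[where i = "\<lambda>(a, b). (a + b, (a, b))" and j = "\<lambda>(v, p). p"])
       (auto simp: add_fiber_def exp_semigroup_add L)
  then show "(\<Sum>\<^sub>\<infinity>v\<in>L. infsum H (add_fiber L v)) = infsum H (L \<times> L)"
    using infsum_Sigma'_banach[OF summable] by simp
qed

lemma infsum_add_fiber_assoc_left:
  fixes G :: "real \<Rightarrow> real \<Rightarrow> real \<Rightarrow> 'b::banach"
  assumes L: "exp_semigroup L" and G: "(\<lambda>(x, y, z). G x y z) summable_on add_fiber3 L v"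
  shows "(\<Sum>\<^sub>\<infinity>(a, z)\<in>add_fiber L v. \<Sum>\<^sub>\<infinity>(x, y)\<in>add_fiber L a. G x y z)
       = (\<Sum>\<^sub>\<infinity>(x, y, z)\<in>add_fiber3 L v. G x y z)"
proof -
  have summable: "(\<lambda>((a, z), (x, y)). G x y z) summable_on Sigma (add_fiber L v) (\<lambda>(a, z). add_fiber L a)"
    using G by (subst summable_on_reindex_bij_witness[where j = "\<lambda>((a, z), (x, y)). (x, y, z)"
          and i = "\<lambda>(x, y, z). ((x + y, z), (x, y))" and T = "add_fiber3 L v" and h = "\<lambda>(x, y, z). G x y z"])
      (auto simp: add_fiber_def add_fiber3_def exp_semigroup_add L)
  have "(\<Sum>\<^sub>\<infinity>(a, z)\<in>add_fiber L v. \<Sum>\<^sub>\<infinity>(x, y)\<in>add_fiber L a. G x y z)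
      = (\<Sum>\<^sub>\<infinity>((a, z), (x, y))\<in>Sigma (add_fiber L v) (\<lambda>(a, z). add_fiber L a). G x y z)"
    using infsum_Sigma'_banach[OF summable] by (simp add: case_prod_unfold)
  also have "\<dots> = (\<Sum>\<^sub>\<infinity>(x, y, z)\<in>add_fiber3 L v. G x y z)"
    by (rule infsum_reindex_bij_witness[where j = "\<lambda>((a, z), (x, y)). (x, y, z)"
          and i = "\<lambda>(x, y, z). ((x + y, z), (x, y))"])
       (auto simp: add_fiber_def add_fiber3_def exp_semigroup_add L)
  finally show ?thesis .
qed

lemma infsum_add_fiber_assoc_right:
  fixes G :: "real \<Rightarrow> real \<Rightarrow> real \<Rightarrow> 'b::banach"
  assumes L: "exp_semigroup L" and G: "(\<lambda>(x, y, z). G x y z) summable_on add_fiber3 L v"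
  shows "(\<Sum>\<^sub>\<infinity>(x, a)\<in>add_fiber L v. \<Sum>\<^sub>\<infinity>(y, z)\<in>add_fiber L a. G x y z)
       = (\<Sum>\<^sub>\<infinity>(x, y, z)\<in>add_fiber3 L v. G x y z)"
proof -
  have summable: "(\<lambda>((x, a), (y, z)). G x y z) summable_on Sigma (add_fiber L v) (\<lambda>(x, a). add_fiber L a)"
    using G by (subst summable_on_reindex_bij_witness[where j = "\<lambda>((x, a), (y, z)). (x, y, z)"
          and i = "\<lambda>(x, y, z). ((x, y + z), (y, z))" and T = "add_fiber3 L v" and h = "\<lambda>(x, y, z). G x y z"])
      (auto simp: add_fiber_def add_fiber3_def exp_semigroup_add add.assoc L)
  have "(\<Sum>\<^sub>\<infinity>(x, a)\<in>add_fiber L v. \<Sum>\<^sub>\<infinity>(y, z)\<in>add_fiber L a. G x y z)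
      = (\<Sum>\<^sub>\<infinity>((x, a), (y, z))\<in>Sigma (add_fiber L v) (\<lambda>(x, a). add_fiber L a). G x y z)"
    using infsum_Sigma'_banach[OF summable] by (simp add: case_prod_unfold)
  also have "\<dots> = (\<Sum>\<^sub>\<infinity>(x, y, z)\<in>add_fiber3 L v. G x y z)"
    by (rule infsum_reindex_bij_witness[where j = "\<lambda>((x, a), (y, z)). (x, y, z)"
          and i = "\<lambda>(x, y, z). ((x, y + z), (y, z))"])
       (auto simp: add_fiber_def add_fiber3_def exp_semigroup_add add.assoc L)
  finally show ?thesis .
qed

section \<open>Admissible weights and their local renorming\<close>

definition nonneg_submultiplicative_on :: "real set \<Rightarrow> (real \<Rightarrow> real) \<Rightarrow> bool" where
  "nonneg_submultiplicative_on L \<sigma> \<longleftrightarrow>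
     (\<forall>x\<in>L. 0 \<le> \<sigma> x) \<and> (\<forall>a\<in>L. \<forall>b\<in>L. \<sigma> (a + b) \<le> \<sigma> a * \<sigma> b)"

lemma nonneg_submultiplicative_on_const_1: "nonneg_submultiplicative_on L (\<lambda>_. 1)"
  by (simp add: nonneg_submultiplicative_on_def)

lemma
  assumes "weight_on L w"
  shows weight_on_ge_1: "x \<in> L \<Longrightarrow> 1 \<le> w x"
    and weight_on_zero: "w 0 = 1"
    and weight_on_add_le: "a \<in> L \<Longrightarrow> b \<in> L \<Longrightarrow> w (a + b) \<le> w a * w b"
  using assms by (simp_all add: weight_on_def)

lemma weight_on_imp_nonneg_submultiplicative_on:
  "weight_on L w \<Longrightarrow> nonneg_submultiplicative_on L w"
  by (auto simp: nonneg_submultiplicative_on_def weight_on_def intro: order.trans[OF zero_le_one])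

lemma admissible_weight_imp_weight_on: "admissible_weight L w \<Longrightarrow> weight_on L w"
  by (simp add: admissible_weight_def)

lemma admissible_weight_nat_mult_le:
  assumes L: "exp_semigroup L" and w: "admissible_weight L w" and m: "m \<in> L" and \<rho>: "1 < \<rho>"
  shows "\<exists>C\<ge>1. \<forall>n. w (real n * m) \<le> C * \<rho> ^ n"
proof -
  have "real n * m \<in> L" for n
    using exp_semigroup_lincomb[OF L, of "{m}" "\<lambda>_. n"] m by simp
  then have w1: "1 \<le> w (real n * m)" for n
    using weight_on_ge_1[OF admissible_weight_imp_weight_on[OF w]] by blast
  have "(\<lambda>n. root n (w (real n * m))) \<longlonglongrightarrow> 1"
    using w m by (simp add: admissible_weight_def)
  then have "eventually (\<lambda>n. root n (w (real n * m)) < \<rho>) sequentially"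
    using \<rho> by (rule order_tendstoD)
  then obtain N where N: "\<And>n. N \<le> n \<Longrightarrow> root n (w (real n * m)) < \<rho>"
    by (auto simp: eventually_sequentially)
  define C where "C = 1 + (\<Sum>k\<le>N. w (real k * m))"
  have C1: "1 \<le> C"
    using w1 by (auto simp: C_def intro: sum_nonneg order.trans[OF zero_le_one])
  have "w (real n * m) \<le> C * \<rho> ^ n" for n
  proof (cases "n \<le> N")
    case True
    have "w (real n * m) \<le> (\<Sum>k\<le>N. w (real k * m))"
      using True w1 by (intro member_le_sum) (auto intro: order.trans[OF zero_le_one])
    also have "\<dots> \<le> C * 1"
      by (simp add: C_def)
    also have "\<dots> \<le> C * \<rho> ^ n"
      using C1 \<rho> by (intro mult_left_mono one_le_power) auto
    finally show ?thesis .
  next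
    case False
    then have "0 < n"
      by simp
    then have "w (real n * m) = root n (w (real n * m)) ^ n"
      using w1[of n] by simp
    also have "\<dots> \<le> \<rho> ^ n"
      using N[of n] False w1[of n] by (intro power_mono) auto
    also have "\<dots> \<le> C * \<rho> ^ n"
      using C1 \<rho> by simp
    finally show ?thesis .
  qed
  with C1 show ?thesis
    by blast
qed

lemma admissible_weight_lincomb_le:
  assumes L: "exp_semigroup L" and w: "admissible_weight L w" and \<rho>: "1 < \<rho>"
    and F: "finite F" "F \<subseteq> L"
  shows "\<exists>C\<ge>1. \<forall>n. w (\<Sum>m\<in>F. real (n m) * m) \<le> C * \<rho> ^ (\<Sum>m\<in>F. n m)"
  using F
proof (induction F rule: finite_induct)
  case empty
  then show ?case
    using weight_on_zero[OF admissible_weight_imp_weight_on[OF w]] by auto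
next
  case (insert x F)
  obtain C where C: "1 \<le> C" "\<And>n. w (\<Sum>m\<in>F. real (n m) * m) \<le> C * \<rho> ^ (\<Sum>m\<in>F. n m)"
    using insert by auto
  obtain C' where C': "1 \<le> C'" "\<And>k. w (real k * x) \<le> C' * \<rho> ^ k"
    using admissible_weight_nat_mult_le[OF L w _ \<rho>, of x] insert by auto
  note weight = admissible_weight_imp_weight_on[OF w]
  have "w (\<Sum>m\<in>insert x F. real (n m) * m) \<le> (C' * C) * \<rho> ^ (\<Sum>m\<in>insert x F. n m)" for n
  proof -
    have x: "real (n x) * x \<in> L" and rest: "(\<Sum>m\<in>F. real (n m) * m) \<in> L"
      using exp_semigroup_lincomb[OF L, of "{x}" "n"] exp_semigroup_lincomb[OF L, of F n] insert
      by auto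
    have "w (\<Sum>m\<in>insert x F. real (n m) * m) = w (real (n x) * x + (\<Sum>m\<in>F. real (n m) * m))"
      using insert by simp
    also have "\<dots> \<le> w (real (n x) * x) * w (\<Sum>m\<in>F. real (n m) * m)"
      by (rule weight_on_add_le[OF weight x rest])
    also have "\<dots> \<le> (C' * \<rho> ^ n x) * (C * \<rho> ^ (\<Sum>m\<in>F. n m))"
      using weight_on_ge_1[OF weight rest] C'(1) \<rho> by (intro mult_mono C'(2) C(2)) auto
    also have "\<dots> = (C' * C) * \<rho> ^ (\<Sum>m\<in>insert x F. n m)"
      using insert by (simp add: power_add algebra_simps)
    finally show ?thesis .
  qed
  moreover have "1 \<le> C' * C"
    using C(1) C'(1) by (metis mult_mono' mult_1 zero_le_one)
  ultimately show ?case
    by blast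
qed

text \<open>The renormed weight of x is the cheapest way to pay for a decomposition
  x = (\<Sum>m\<in>F. n m * m) + t when each use of an exponent of F costs \<rho> and the remainder costs
  w t. Admissibility (subexponential growth of w along each m) is exactly what keeps it
  equivalent to w.\<close>

definition renorm_costs :: "real set \<Rightarrow> (real \<Rightarrow> real) \<Rightarrow> real \<Rightarrow> real set \<Rightarrow> real \<Rightarrow> real set" where
  "renorm_costs L w \<rho> F x =
     {\<rho> ^ (\<Sum>m\<in>F. n m) * w t | n t. t \<in> L \<and> x = (\<Sum>m\<in>F. real (n m) * m) + t}"

definition renormed_weight :: "real set \<Rightarrow> (real \<Rightarrow> real) \<Rightarrow> real \<Rightarrow> real set \<Rightarrow> real \<Rightarrow> real" where
  "renormed_weight L w \<rho> F x = Inf (renorm_costs L w \<rho> F x)"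

context
  fixes L :: "real set" and w :: "real \<Rightarrow> real" and \<rho> :: real and F :: "real set"
  assumes L: "exp_semigroup L" and w: "admissible_weight L w" and \<rho>: "1 < \<rho>"
    and F: "finite F" "F \<subseteq> L"
begin

private lemmas weight = admissible_weight_imp_weight_on[OF w]

private lemma weight_in_renorm_costs: "x \<in> L \<Longrightarrow> w x \<in> renorm_costs L w \<rho> F x"
  unfolding renorm_costs_def by (rule CollectI, rule exI[of _ "\<lambda>_. 0"], rule exI[of _ x]) simp

private lemma renorm_costs_nonneg: "s \<in> renorm_costs L w \<rho> F x \<Longrightarrow> 0 \<le> s"
  using \<rho> weight_on_ge_1[OF weight] by (force simp: renorm_costs_def zero_le_mult_iff)

private lemma renormed_weight_le_cost:
  "s \<in> renorm_costs L w \<rho> F x \<Longrightarrow> renormed_weight L w \<rho> F x \<le> s"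
  unfolding renormed_weight_def using renorm_costs_nonneg by (intro cInf_lower bdd_belowI) auto

lemma renormed_weight_le_weight: "x \<in> L \<Longrightarrow> renormed_weight L w \<rho> F x \<le> w x"
  by (rule renormed_weight_le_cost[OF weight_in_renorm_costs])

lemma renormed_weight_le_base: "x \<in> F \<Longrightarrow> renormed_weight L w \<rho> F x \<le> \<rho>"
proof -
  assume x: "x \<in> F"
  define n where "n m = (if m = x then 1 else 0 :: nat)" for m
  have "(\<Sum>m\<in>F. real (n m) * m) = x" and "(\<Sum>m\<in>F. n m) = 1"
    using x F(1) by (simp_all add: n_def if_distrib if_distribR sum.delta' cong: if_cong)
  then have "\<rho> ^ (\<Sum>m\<in>F. n m) * w 0 \<in> renorm_costs L w \<rho> F x"
    unfolding renorm_costs_def using exp_semigroup_zero[OF L] by force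
  then show ?thesis
    using renormed_weight_le_cost weight_on_zero[OF weight] \<open>(\<Sum>m\<in>F. n m) = 1\<close> by fastforce
qed

lemma weight_le_renormed_weight: "\<exists>C\<ge>1. \<forall>x\<in>L. w x \<le> C * renormed_weight L w \<rho> F x"
proof -
  obtain C where C: "1 \<le> C" "\<And>n. w (\<Sum>m\<in>F. real (n m) * m) \<le> C * \<rho> ^ (\<Sum>m\<in>F. n m)"
    using admissible_weight_lincomb_le[OF L w \<rho> F] by blast
  have "w x / C \<le> s" if x: "x \<in> L" and s: "s \<in> renorm_costs L w \<rho> F x" for x s
  proof -
    obtain n t where nt: "s = \<rho> ^ (\<Sum>m\<in>F. n m) * w t" "t \<in> L" "x = (\<Sum>m\<in>F. real (n m) * m) + t"
      using s unfolding renorm_costs_def by blast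
    have lincomb: "(\<Sum>m\<in>F. real (n m) * m) \<in> L"
      using exp_semigroup_lincomb[OF L F] .
    have "w x \<le> w (\<Sum>m\<in>F. real (n m) * m) * w t"
      using nt(3) weight_on_add_le[OF weight lincomb nt(2)] by simp
    also have "\<dots> \<le> C * s"
      using C(2)[of n] weight_on_ge_1[OF weight nt(2)] nt(1)
      by (simp add: mult.assoc mult_right_mono)
    finally show ?thesis
      using C(1) by (simp add: divide_le_eq mult.commute)
  qed
  then have "w x / C \<le> renormed_weight L w \<rho> F x" if "x \<in> L" for x
    unfolding renormed_weight_def using weight_in_renorm_costs[OF that] that
    by (intro cInf_greatest) auto
  with C(1) show ?thesis
    by (auto simp: divide_le_eq mult.commute)
qed

lemma renormed_weight_pos: "x \<in> L \<Longrightarrow> 0 < renormed_weight L w \<rho> F x"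
proof -
  assume x: "x \<in> L"
  obtain C where "1 \<le> C" "w x \<le> C * renormed_weight L w \<rho> F x"
    using weight_le_renormed_weight x by blast
  with weight_on_ge_1[OF weight x] show ?thesis
    by (smt (verit) mult_nonneg_nonpos)
qed

private lemma renormed_weight_add_le_cost_mult:
  assumes a: "a \<in> L" and b: "b \<in> L"
    and s1: "s1 \<in> renorm_costs L w \<rho> F a" and s2: "s2 \<in> renorm_costs L w \<rho> F b"
  shows "renormed_weight L w \<rho> F (a + b) \<le> s1 * s2"
proof -
  obtain n1 t1 where 1: "s1 = \<rho> ^ (\<Sum>m\<in>F. n1 m) * w t1" "t1 \<in> L" "a = (\<Sum>m\<in>F. real (n1 m) * m) + t1"
    using s1 unfolding renorm_costs_def by blast
  obtain n2 t2 where 2: "s2 = \<rho> ^ (\<Sum>m\<in>F. n2 m) * w t2" "t2 \<in> L" "b = (\<Sum>m\<in>F. real (n2 m) * m) + t2"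
    using s2 unfolding renorm_costs_def by blast
  have "\<rho> ^ (\<Sum>m\<in>F. n1 m + n2 m) * w (t1 + t2) \<in> renorm_costs L w \<rho> F (a + b)"
    unfolding renorm_costs_def
    by (intro CollectI exI[of _ "\<lambda>m. n1 m + n2 m"] exI[of _ "t1 + t2"])
       (use 1 2 exp_semigroup_add[OF L] in \<open>auto simp: sum.distrib algebra_simps\<close>)
  then have "renormed_weight L w \<rho> F (a + b) \<le> \<rho> ^ (\<Sum>m\<in>F. n1 m + n2 m) * w (t1 + t2)"
    by (rule renormed_weight_le_cost)
  also have "\<dots> \<le> \<rho> ^ (\<Sum>m\<in>F. n1 m + n2 m) * (w t1 * w t2)"
    using \<rho> by (intro mult_left_mono weight_on_add_le[OF weight 1(2) 2(2)]) auto
  also have "\<dots> = s1 * s2"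
    using 1 2 by (simp add: sum.distrib power_add algebra_simps)
  finally show ?thesis .
qed

lemma nonneg_submultiplicative_renormed_weight:
  "nonneg_submultiplicative_on L (renormed_weight L w \<rho> F)"
proof -
  let ?\<sigma> = "renormed_weight L w \<rho> F"
  have "?\<sigma> (a + b) \<le> ?\<sigma> a * ?\<sigma> b" if a: "a \<in> L" and b: "b \<in> L" for a b
  proof -
    have "?\<sigma> (a + b) / ?\<sigma> a \<le> s2" if s2: "s2 \<in> renorm_costs L w \<rho> F b" for s2
    proof -
      have "0 < s2"
        using renormed_weight_pos[OF b] renormed_weight_le_cost[OF s2] by linarith
      then have "?\<sigma> (a + b) / s2 \<le> ?\<sigma> a"
        unfolding renormed_weight_def[of L w \<rho> F a]
        using weight_in_renorm_costs[OF a] renormed_weight_add_le_cost_mult[OF a b _ s2]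
        by (intro cInf_greatest) (auto simp: divide_le_eq mult.commute)
      with \<open>0 < s2\<close> renormed_weight_pos[OF a] show ?thesis
        by (simp add: divide_le_eq pos_divide_le_eq mult.commute)
    qed
    then have "?\<sigma> (a + b) / ?\<sigma> a \<le> ?\<sigma> b"
      unfolding renormed_weight_def[of L w \<rho> F b]
      using weight_in_renorm_costs[OF b] by (intro cInf_greatest) auto
    then show ?thesis
      using renormed_weight_pos[OF a] by (simp add: divide_le_eq mult.commute)
  qed
  then show ?thesis
    using renormed_weight_pos by (auto simp: nonneg_submultiplicative_on_def less_imp_le)
qed

end

section \<open>Weighted convolution algebras\<close>

locale unital_bounded_algebra = bounded_bilinear mul
  for mul :: "'a::banach \<Rightarrow> 'a \<Rightarrow> 'a" +
  fixes one :: 'a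
  assumes mul_assoc: "mul (mul x y) z = mul x (mul y z)"
    and mul_one_left: "mul one x = x"
    and mul_one_right: "mul x one = x"
begin

definition mul_bound :: real where
  "mul_bound = (SOME K. 0 < K \<and> (\<forall>a b. norm (mul a b) \<le> norm a * norm b * K))"

lemma mul_bound_pos: "0 < mul_bound"
  and norm_mul_le: "norm (mul a b) \<le> mul_bound * (norm a * norm b)"
proof -
  have "0 < mul_bound \<and> (\<forall>a b. norm (mul a b) \<le> norm a * norm b * mul_bound)"
    unfolding mul_bound_def using pos_bounded by (rule someI_ex)
  then show "0 < mul_bound" and "norm (mul a b) \<le> mul_bound * (norm a * norm b)"
    by (auto simp: mult.commute)
qed

end

locale dirichlet_algebra = unital_bounded_algebra mul one
  for mul :: "'a::banach \<Rightarrow> 'a \<Rightarrow> 'a" and one +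
  fixes L :: "real set"
  assumes exp_semigroup: "exp_semigroup L"
begin

abbreviation conv :: "(real \<Rightarrow> 'a) \<Rightarrow> (real \<Rightarrow> 'a) \<Rightarrow> real \<Rightarrow> 'a" where
  "conv \<equiv> dconv mul L"

definition supported :: "(real \<Rightarrow> 'a) \<Rightarrow> bool" where
  "supported f \<longleftrightarrow> (\<forall>x. x \<notin> L \<longrightarrow> f x = 0)"

definition wsummable :: "(real \<Rightarrow> real) \<Rightarrow> (real \<Rightarrow> 'a) \<Rightarrow> bool" where
  "wsummable w f \<longleftrightarrow> (\<lambda>x. norm (f x) * w x) summable_on L"

definition wnorm :: "(real \<Rightarrow> real) \<Rightarrow> (real \<Rightarrow> 'a) \<Rightarrow> real" where
  "wnorm w f = (\<Sum>\<^sub>\<infinity>x\<in>L. norm (f x) * w x)"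

abbreviation l1 :: "(real \<Rightarrow> 'a) \<Rightarrow> bool" where
  "l1 \<equiv> wsummable (\<lambda>_. 1)"

abbreviation norm1 :: "(real \<Rightarrow> 'a) \<Rightarrow> real" where
  "norm1 \<equiv> wnorm (\<lambda>_. 1)"

lemma wnorm_nonneg: "(\<And>x. x \<in> L \<Longrightarrow> 0 \<le> w x) \<Longrightarrow> 0 \<le> wnorm w f"
  unfolding wnorm_def by (intro infsum_nonneg) auto

lemma
  assumes f: "wsummable w f" and w': "\<And>x. x \<in> L \<Longrightarrow> 0 \<le> w' x"
    and le: "\<And>x. x \<in> L \<Longrightarrow> w' x \<le> C * w x"
  shows wsummable_mono_weight: "wsummable w' f"
    and wnorm_mono_weight: "wnorm w' f \<le> C * wnorm w f"
proof -
  have bound: "(\<lambda>x. C * (norm (f x) * w x)) summable_on L"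
    using f unfolding wsummable_def by (rule summable_on_cmult_right)
  have pointwise: "norm (f x) * w' x \<le> C * (norm (f x) * w x)" if "x \<in> L" for x
    using mult_left_mono[OF le[OF that] norm_ge_zero[of "f x"]] by (simp add: algebra_simps)
  show summable: "wsummable w' f"
    unfolding wsummable_def
    by (rule summable_on_comparison_test[OF bound]) (use pointwise w' in auto)
  have "wnorm w' f \<le> (\<Sum>\<^sub>\<infinity>x\<in>L. C * (norm (f x) * w x))"
    unfolding wnorm_def using summable bound pointwise
    by (intro infsum_mono) (auto simp: wsummable_def)
  then show "wnorm w' f \<le> C * wnorm w f"
    by (simp add: wnorm_def infsum_cmult_right')
qed

lemma wsummable_imp_l1: "weight_on L w \<Longrightarrow> wsummable w f \<Longrightarrow> l1 f"
  using wsummable_mono_weight[of w f "\<lambda>_. 1" 1] weight_on_ge_1 by auto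

lemma wsummable_finite_support: "finite {x\<in>L. f x \<noteq> 0} \<Longrightarrow> wsummable w f"
  unfolding wsummable_def
  by (rule finite_nonzero_values_imp_summable_on) (auto elim: finite_subset[rotated])

lemma norm_le_norm1: "l1 f \<Longrightarrow> v \<in> L \<Longrightarrow> norm (f v) \<le> norm1 f"
  using finite_sum_le_infsum[of "\<lambda>x. norm (f x) * 1" L "{v}"]
  by (simp add: wsummable_def wnorm_def)

lemma wsummable_diff:
  assumes "wsummable w f" and "wsummable w g" and "\<And>x. x \<in> L \<Longrightarrow> 0 \<le> w x"
  shows "wsummable w (\<lambda>x. f x - g x)"
proof -
  have bound: "(\<lambda>x. norm (f x) * w x + norm (g x) * w x) summable_on L"
    using assms(1,2) unfolding wsummable_def by (rule summable_on_add)
  have "norm (f x - g x) * w x \<le> norm (f x) * w x + norm (g x) * w x" if "x \<in> L" for x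
    using mult_right_mono[OF norm_triangle_ineq4[of "f x" "g x"] assms(3)[OF that]]
    by (simp add: algebra_simps)
  then show ?thesis
    unfolding wsummable_def
    by (rule summable_on_comparison_test[OF bound]) (use assms(3) in auto)
qed

lemma wnorm_tail_small:
  assumes w: "\<And>x. x \<in> L \<Longrightarrow> 0 \<le> w x" and f: "wsummable w f" and \<epsilon>: "0 < \<epsilon>"
  obtains G where "finite G" and "G \<subseteq> L" and "wnorm w (\<lambda>x. if x \<in> G then 0 else f x) \<le> \<epsilon>"
proof -
  let ?h = "\<lambda>x. norm (f x) * w x"
  obtain G where G: "finite G" "G \<subseteq> L" "dist (sum ?h G) (infsum ?h L) \<le> \<epsilon>"
    using infsum_finite_approximation[of ?h L \<epsilon>] f \<epsilon> unfolding wsummable_def by blast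
  have "((\<lambda>x. if x \<in> G then ?h x else 0) has_sum sum ?h G) L"
    using G(1,2) by (subst has_sum_cong_neutral[where T = G]) auto
  with has_sum_infsum[of ?h L] f
  have "((\<lambda>x. ?h x - (if x \<in> G then ?h x else 0)) has_sum (infsum ?h L - sum ?h G)) L"
    unfolding wsummable_def by (intro has_sum_diff) auto
  then have "wnorm w (\<lambda>x. if x \<in> G then 0 else f x) = infsum ?h L - sum ?h G"
    unfolding wnorm_def by (intro infsumI) (auto elim!: has_sum_cong[THEN iffD1, rotated])
  with G show ?thesis
    using that by (simp add: dist_real_def)
qed

lemma wsummable_dunit: "wsummable w (dunit one)"
  by (rule wsummable_finite_support) (auto simp: dunit_def intro: finite_subset[of _ "{0}"])

lemma wnorm_dunit: "wnorm w (dunit one) = norm one * w 0"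
proof -
  have "wnorm w (dunit one) = (\<Sum>\<^sub>\<infinity>x\<in>{0}. norm (dunit one x) * w x)"
    unfolding wnorm_def using exp_semigroup_zero[OF exp_semigroup]
    by (intro infsum_cong_neutral) (auto simp: dunit_def)
  then show ?thesis
    by (simp add: dunit_def)
qed

lemma norm_mul_summable_on_product:
  assumes "l1 f" and "l1 g"
  shows "(\<lambda>(a, b). norm (f a) * norm (g b)) summable_on L \<times> L"
  using has_sum_product_nonneg[of L "\<lambda>a. norm (f a)" L "\<lambda>b. norm (g b)"] assms
  by (auto simp: wsummable_def summable_on_def)

lemma abs_summable_mul_on_product:
  assumes "l1 f" and "l1 g"
  shows "(\<lambda>(a, b). norm (mul (f a) (g b))) summable_on L \<times> L"
proof (rule summable_on_comparison_test)
  show "(\<lambda>p. mul_bound * (case p of (a, b) \<Rightarrow> norm (f a) * norm (g b))) summable_on L \<times> L"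
    using norm_mul_summable_on_product[OF assms] by (rule summable_on_cmult_right)
qed (auto simp: norm_mul_le)

lemma
  assumes "l1 f" and "l1 g"
  shows abs_summable_mul_on_add_fiber:
      "(\<lambda>(a, b). norm (mul (f a) (g b))) summable_on add_fiber L v"
    and summable_mul_on_add_fiber: "(\<lambda>(a, b). mul (f a) (g b)) summable_on add_fiber L v"
proof -
  show abs: "(\<lambda>(a, b). norm (mul (f a) (g b))) summable_on add_fiber L v"
    by (rule summable_on_subset_banach[OF abs_summable_mul_on_product[OF assms] add_fiber_subset])
  then have "(\<lambda>p. norm ((\<lambda>(a, b). mul (f a) (g b)) p)) summable_on add_fiber L v"
    by (simp add: case_prod_unfold)
  then show "(\<lambda>(a, b). mul (f a) (g b)) summable_on add_fiber L v"
    by (rule abs_summable_summable)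
qed

lemma norm_conv_mult_weight_le:
  assumes w: "nonneg_submultiplicative_on L w" and f: "l1 f" and g: "l1 g" and v: "v \<in> L"
    and Q: "(\<lambda>(a, b). mul_bound * (norm (f a) * w a) * (norm (g b) * w b)) summable_on add_fiber L v"
  shows "norm (conv f g v) * w v
      \<le> (\<Sum>\<^sub>\<infinity>(a, b)\<in>add_fiber L v. mul_bound * (norm (f a) * w a) * (norm (g b) * w b))"
proof -
  have "norm (conv f g v) \<le> (\<Sum>\<^sub>\<infinity>p\<in>add_fiber L v. norm ((\<lambda>(a, b). mul (f a) (g b)) p))"
    unfolding dconv_eq_infsum_add_fiber
    by (rule norm_infsum_bound) (use abs_summable_mul_on_add_fiber[OF f g] in \<open>simp add: case_prod_unfold\<close>)
  then have "norm (conv f g v) \<le> (\<Sum>\<^sub>\<infinity>(a, b)\<in>add_fiber L v. norm (mul (f a) (g b)))"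
    by (simp add: case_prod_unfold)
  then have "norm (conv f g v) * w v \<le> (\<Sum>\<^sub>\<infinity>(a, b)\<in>add_fiber L v. norm (mul (f a) (g b)) * w v)"
    using w v by (auto simp: nonneg_submultiplicative_on_def infsum_cmult_left' case_prod_unfold
        intro: mult_right_mono)
  also have "\<dots> \<le> (\<Sum>\<^sub>\<infinity>(a, b)\<in>add_fiber L v. mul_bound * (norm (f a) * w a) * (norm (g b) * w b))"
  proof (rule infsum_mono[OF _ Q])
    show "(\<lambda>(a, b). norm (mul (f a) (g b)) * w v) summable_on add_fiber L v"
      using summable_on_cmult_left[OF abs_summable_mul_on_add_fiber[OF f g]]
      by (simp add: case_prod_unfold)
    fix p assume "p \<in> add_fiber L v"
    then obtain a b where ab: "p = (a, b)" "a \<in> L" "b \<in> L" "v = a + b"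
      by (auto simp: add_fiber_def)
    have "norm (mul (f a) (g b)) * w (a + b) \<le> mul_bound * (norm (f a) * norm (g b)) * (w a * w b)"
      using w ab mul_bound_pos exp_semigroup_add[OF exp_semigroup] unfolding nonneg_submultiplicative_on_def
      by (intro mult_mono norm_mul_le) (auto intro!: mult_nonneg_nonneg)
    then show "(case p of (a, b) \<Rightarrow> norm (mul (f a) (g b)) * w v)
        \<le> (case p of (a, b) \<Rightarrow> mul_bound * (norm (f a) * w a) * (norm (g b) * w b))"
      using ab by (simp add: algebra_simps)
  qed
  finally show ?thesis .
qed

lemma
  assumes w: "nonneg_submultiplicative_on L w" and f: "l1 f" "wsummable w f"
    and g: "l1 g" "wsummable w g"
  shows wsummable_conv: "wsummable w (conv f g)"
    and wnorm_conv_le: "wnorm w (conv f g) \<le> mul_bound * wnorm w f * wnorm w g"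
proof -
  define Q where "Q = (\<lambda>(a, b). mul_bound * (norm (f a) * w a) * (norm (g b) * w b))"
  have "((\<lambda>(a, b). (norm (f a) * w a) * (norm (g b) * w b)) has_sum (wnorm w f * wnorm w g)) (L \<times> L)"
    using w f(2) g(2)
    by (intro has_sum_product_nonneg) (auto simp: wsummable_def wnorm_def nonneg_submultiplicative_on_def)
  from has_sum_cmult_right[OF this, of mul_bound]
  have Q_sum: "(Q has_sum mul_bound * wnorm w f * wnorm w g) (L \<times> L)"
    by (simp add: Q_def case_prod_unfold mult.assoc)
  then have Q_summable: "Q summable_on L \<times> L"
    by (auto simp: summable_on_def)
  have Q_fiber: "Q summable_on add_fiber L v" for v
    using Q_summable add_fiber_subset by (rule summable_on_subset_banach)
  have bound: "norm (conv f g v) * w v \<le> infsum Q (add_fiber L v)" if "v \<in> L" for v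
    unfolding Q_def using norm_conv_mult_weight_le[OF w f(1) g(1) that] Q_fiber by (simp add: Q_def)
  have nonneg: "0 \<le> norm (conv f g v) * w v" if "v \<in> L" for v
    using w that by (simp add: nonneg_submultiplicative_on_def)
  have fibers: "(\<lambda>v. infsum Q (add_fiber L v)) summable_on L"
    using summable_on_infsum_add_fiber[OF exp_semigroup Q_summable] .
  show summable: "wsummable w (conv f g)"
    unfolding wsummable_def by (rule summable_on_comparison_test[OF fibers bound nonneg])
  have "wnorm w (conv f g) \<le> (\<Sum>\<^sub>\<infinity>v\<in>L. infsum Q (add_fiber L v))"
    unfolding wnorm_def using summable fibers bound by (intro infsum_mono) (auto simp: wsummable_def)
  also have "\<dots> = mul_bound * wnorm w f * wnorm w g"
    using infsum_infsum_add_fiber[OF exp_semigroup Q_summable] infsumI[OF Q_sum] by simp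
  finally show "wnorm w (conv f g) \<le> mul_bound * wnorm w f * wnorm w g" .
qed

lemma supported_conv: "supported (conv f g)"
  by (simp add: supported_def dconv_eq_infsum_add_fiber add_fiber_empty[OF exp_semigroup])

lemma conv_diff_left:
  assumes "l1 f1" and "l1 f2" and "l1 g"
  shows "conv (\<lambda>x. f1 x - f2 x) g = (\<lambda>v. conv f1 g v - conv f2 g v)"
proof
  fix v
  have "((\<lambda>(a, b). mul (f1 a) (g b) - mul (f2 a) (g b)) has_sum (conv f1 g v - conv f2 g v))
      (add_fiber L v)"
    unfolding dconv_eq_infsum_add_fiber
    using has_sum_diff[OF summable_mul_on_add_fiber[OF assms(1,3), THEN has_sum_infsum]
        summable_mul_on_add_fiber[OF assms(2,3), THEN has_sum_infsum]]
    by (simp add: case_prod_unfold)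
  then show "conv (\<lambda>x. f1 x - f2 x) g v = conv f1 g v - conv f2 g v"
    by (simp add: dconv_eq_infsum_add_fiber diff_left case_prod_unfold infsumI)
qed

lemma conv_diff_right:
  assumes "l1 f" and "l1 g1" and "l1 g2"
  shows "conv f (\<lambda>x. g1 x - g2 x) = (\<lambda>v. conv f g1 v - conv f g2 v)"
proof
  fix v
  have "((\<lambda>(a, b). mul (f a) (g1 b) - mul (f a) (g2 b)) has_sum (conv f g1 v - conv f g2 v))
      (add_fiber L v)"
    unfolding dconv_eq_infsum_add_fiber
    using has_sum_diff[OF summable_mul_on_add_fiber[OF assms(1,2), THEN has_sum_infsum]
        summable_mul_on_add_fiber[OF assms(1,3), THEN has_sum_infsum]]
    by (simp add: case_prod_unfold)
  then show "conv f (\<lambda>x. g1 x - g2 x) v = conv f g1 v - conv f g2 v"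
    by (simp add: dconv_eq_infsum_add_fiber diff_right case_prod_unfold infsumI)
qed

lemma conv_dunit_right: "supported f \<Longrightarrow> conv f (dunit one) = f"
proof
  fix v
  assume f: "supported f"
  show "conv f (dunit one) v = f v"
  proof (cases "v \<in> L")
    case False
    with f show ?thesis
      by (simp add: dconv_eq_infsum_add_fiber add_fiber_empty[OF exp_semigroup] supported_def)
  next
    case True
    have "conv f (dunit one) v = (\<Sum>\<^sub>\<infinity>(a, b)\<in>{(v, 0::real)}. mul (f a) one)"
      unfolding dconv_eq_infsum_add_fiber
      by (rule infsum_cong_neutral)
         (use True exp_semigroup_zero[OF exp_semigroup] in \<open>auto simp: add_fiber_def dunit_def zero_right split: if_splits\<close>)
    then show ?thesis
      by (simp add: mul_one_right)
  qed
qed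

lemma conv_dunit_left: "supported f \<Longrightarrow> conv (dunit one) f = f"
proof
  fix v
  assume f: "supported f"
  show "conv (dunit one) f v = f v"
  proof (cases "v \<in> L")
    case False
    with f show ?thesis
      by (simp add: dconv_eq_infsum_add_fiber add_fiber_empty[OF exp_semigroup] supported_def)
  next
    case True
    have "conv (dunit one) f v = (\<Sum>\<^sub>\<infinity>(a, b)\<in>{(0::real, v)}. mul one (f b))"
      unfolding dconv_eq_infsum_add_fiber
      by (rule infsum_cong_neutral)
         (use True exp_semigroup_zero[OF exp_semigroup] in \<open>auto simp: add_fiber_def dunit_def zero_left split: if_splits\<close>)
    then show ?thesis
      by (simp add: mul_one_left)
  qed
qed

lemma mul_conv_left:
  assumes "l1 f" and "l1 g"
  shows "mul (conv f g a) z = (\<Sum>\<^sub>\<infinity>(x, y)\<in>add_fiber L a. mul (mul (f x) (g y)) z)"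
  using has_sum_bounded_linear[OF bounded_linear_left
      summable_mul_on_add_fiber[OF assms, THEN has_sum_infsum], of z a]
  by (simp add: dconv_eq_infsum_add_fiber case_prod_unfold infsumI)

lemma mul_conv_right:
  assumes "l1 g" and "l1 h"
  shows "mul z (conv g h a) = (\<Sum>\<^sub>\<infinity>(y, x)\<in>add_fiber L a. mul z (mul (g y) (h x)))"
  using has_sum_bounded_linear[OF bounded_linear_right
      summable_mul_on_add_fiber[OF assms, THEN has_sum_infsum], of z a]
  by (simp add: dconv_eq_infsum_add_fiber case_prod_unfold infsumI)

lemma summable_mul3_on_add_fiber3:
  assumes f: "l1 f" and g: "l1 g" and h: "l1 h"
  shows "(\<lambda>(x, y, z). mul (mul (f x) (g y)) (h z)) summable_on add_fiber3 L v"
proof -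
  have "((\<lambda>(x, p). norm (f x) * (case p of (y, z) \<Rightarrow> norm (g y) * norm (h z)))
      has_sum (norm1 f * (norm1 g * norm1 h))) (L \<times> (L \<times> L))"
    using assms
    by (intro has_sum_product_nonneg) (auto simp: wsummable_def wnorm_def intro!: has_sum_product_nonneg)
  from summable_on_cmult_right[OF this[THEN has_sum_imp_summable], of "mul_bound * mul_bound"]
  have bound: "(\<lambda>(x, y, z). mul_bound * mul_bound * (norm (f x) * (norm (g y) * norm (h z))))
      summable_on L \<times> (L \<times> L)"
    by (simp add: case_prod_unfold)
  have "norm (mul (mul (f x) (g y)) (h z))
      \<le> mul_bound * mul_bound * (norm (f x) * (norm (g y) * norm (h z)))" for x y z
  proof -
    have "norm (mul (mul (f x) (g y)) (h z)) \<le> mul_bound * (norm (mul (f x) (g y)) * norm (h z))"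
      by (rule norm_mul_le)
    also have "\<dots> \<le> mul_bound * ((mul_bound * (norm (f x) * norm (g y))) * norm (h z))"
      using mul_bound_pos by (intro mult_left_mono mult_right_mono norm_mul_le) auto
    finally show ?thesis
      by (simp add: mult_ac)
  qed
  then have "(\<lambda>p. norm ((\<lambda>(x, y, z). mul (mul (f x) (g y)) (h z)) p)) summable_on L \<times> (L \<times> L)"
    by (intro summable_on_comparison_test[OF bound]) auto
  then have "(\<lambda>(x, y, z). mul (mul (f x) (g y)) (h z)) summable_on L \<times> (L \<times> L)"
    by (rule abs_summable_summable)
  then show ?thesis
    by (rule summable_on_subset_banach) (auto simp: add_fiber3_def)
qed

lemma conv_assoc:
  assumes f: "l1 f" and g: "l1 g" and h: "l1 h"
  shows "conv (conv f g) h = conv f (conv g h)"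
proof
  fix v
  have "conv (conv f g) h v
      = (\<Sum>\<^sub>\<infinity>(a, z)\<in>add_fiber L v. \<Sum>\<^sub>\<infinity>(x, y)\<in>add_fiber L a. mul (mul (f x) (g y)) (h z))"
    by (simp add: dconv_eq_infsum_add_fiber[of _ _ "conv f g"] mul_conv_left[OF f g])
  also have "\<dots> = (\<Sum>\<^sub>\<infinity>(x, y, z)\<in>add_fiber3 L v. mul (mul (f x) (g y)) (h z))"
    using infsum_add_fiber_assoc_left[OF exp_semigroup summable_mul3_on_add_fiber3[OF f g h]] .
  also have "\<dots> = (\<Sum>\<^sub>\<infinity>(x, a)\<in>add_fiber L v. \<Sum>\<^sub>\<infinity>(y, z)\<in>add_fiber L a. mul (f x) (mul (g y) (h z)))"
    using infsum_add_fiber_assoc_right[OF exp_semigroup summable_mul3_on_add_fiber3[OF f g h]]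
    by (simp add: mul_assoc)
  also have "\<dots> = conv f (conv g h) v"
    by (simp add: dconv_eq_infsum_add_fiber[of _ _ _ "conv g h"] mul_conv_right[OF g h])
  finally show "conv (conv f g) h v = conv f (conv g h) v" .
qed

definition conv_power :: "(real \<Rightarrow> 'a) \<Rightarrow> nat \<Rightarrow> real \<Rightarrow> 'a" where
  "conv_power r k = (conv r ^^ k) (dunit one)"

lemma conv_power_0 [simp]: "conv_power r 0 = dunit one"
  by (simp add: conv_power_def)

lemma conv_power_Suc [simp]: "conv_power r (Suc k) = conv r (conv_power r k)"
  by (simp add: conv_power_def)

lemma
  assumes w: "nonneg_submultiplicative_on L w" and r: "l1 r" "wsummable w r"
  shows l1_conv_power: "l1 (conv_power r k)"
    and wsummable_conv_power: "wsummable w (conv_power r k)"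
    and wnorm_conv_power_le: "wnorm w (conv_power r k) \<le> norm one * w 0 * (mul_bound * wnorm w r) ^ k"
proof -
  have "l1 (conv_power r k) \<and> wsummable w (conv_power r k)
      \<and> wnorm w (conv_power r k) \<le> norm one * w 0 * (mul_bound * wnorm w r) ^ k"
  proof (induction k)
    case 0
    show ?case
      by (simp add: wsummable_dunit wnorm_dunit)
  next
    case (Suc k)
    then have "wnorm w (conv r (conv_power r k)) \<le> mul_bound * wnorm w r * wnorm w (conv_power r k)"
      using w r by (intro wnorm_conv_le) auto
    also have "\<dots> \<le> mul_bound * wnorm w r * (norm one * w 0 * (mul_bound * wnorm w r) ^ k)"
      using Suc mul_bound_pos wnorm_nonneg[of w r] w
      by (intro mult_left_mono) (auto simp: nonneg_submultiplicative_on_def)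
    finally show ?case
      using Suc w r nonneg_submultiplicative_on_const_1
      by (auto intro!: wsummable_conv simp: mult_ac)
  qed
  then show "l1 (conv_power r k)" and "wsummable w (conv_power r k)"
    and "wnorm w (conv_power r k) \<le> norm one * w 0 * (mul_bound * wnorm w r) ^ k"
    by auto
qed

lemma conv_telescope:
  assumes e: "supported e" "l1 e" and g: "l1 g" and r: "l1 r"
    and er: "conv e r = (\<lambda>x. e x - g x)"
  shows "(\<Sum>k<N. conv g (conv_power r k) v) = e v - conv e (conv_power r N) v"
proof (induction N)
  case 0
  then show ?case
    by (simp add: conv_dunit_right[OF e(1)])
next
  case (Suc N)
  have power: "l1 (conv_power r N)"
    using l1_conv_power[OF nonneg_submultiplicative_on_const_1 r r] .
  have "conv e (conv_power r (Suc N)) = conv (conv e r) (conv_power r N)"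
    using conv_assoc[OF e(2) r power] by simp
  also have "\<dots> = (\<lambda>v. conv e (conv_power r N) v - conv g (conv_power r N) v)"
    using conv_diff_left[OF e(2) g power] er by simp
  finally show ?case
    using Suc by simp
qed

lemma wsummable_of_series:
  assumes w: "\<And>x. x \<in> L \<Longrightarrow> 0 \<le> w x"
    and lim: "\<And>v. v \<in> L \<Longrightarrow> (\<lambda>N. \<Sum>k<N. a k v) \<longlonglongrightarrow> e v"
    and a: "\<And>k. wsummable w (a k)" and bound: "\<And>N. (\<Sum>k<N. wnorm w (a k)) \<le> M"
  shows "wsummable w e"
  unfolding wsummable_def
proof (rule nonneg_bdd_above_summable_on)
  show "0 \<le> norm (e x) * w x" if "x \<in> L" for x
    using w[OF that] by simp
  have "(\<Sum>v\<in>G. norm (e v) * w v) \<le> M" if G: "finite G" "G \<subseteq> L" for G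
  proof (rule LIMSEQ_le_const2)
    show "(\<lambda>N. \<Sum>v\<in>G. norm (\<Sum>k<N. a k v) * w v) \<longlonglongrightarrow> (\<Sum>v\<in>G. norm (e v) * w v)"
      using G lim by (intro tendsto_intros) auto
    have "(\<Sum>v\<in>G. norm (\<Sum>k<N. a k v) * w v) \<le> M" for N
    proof -
      have "(\<Sum>v\<in>G. norm (\<Sum>k<N. a k v) * w v) \<le> (\<Sum>v\<in>G. \<Sum>k<N. norm (a k v) * w v)"
        using w G by (intro sum_mono) (auto simp: sum_distrib_right[symmetric] intro!: mult_right_mono norm_sum)
      also have "\<dots> = (\<Sum>k<N. \<Sum>v\<in>G. norm (a k v) * w v)"
        by (rule sum.swap)
      also have "\<dots> \<le> (\<Sum>k<N. wnorm w (a k))"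
        unfolding wnorm_def using G a w
        by (intro sum_mono finite_sum_le_infsum) (auto simp: wsummable_def)
      finally show ?thesis
        using bound[of N] by linarith
    qed
    then show "\<exists>N0. \<forall>N\<ge>N0. (\<Sum>v\<in>G. norm (\<Sum>k<N. a k v) * w v) \<le> M"
      by blast
  qed
  then show "bdd_above (sum (\<lambda>x. norm (e x) * w x) ` {G. G \<subseteq> L \<and> finite G})"
    by (auto intro!: bdd_aboveI[where M = M])
qed

lemma
  assumes \<sigma>: "nonneg_submultiplicative_on L \<sigma>" and r: "l1 r" "wsummable \<sigma> r"
    and v: "\<And>x. x \<in> L \<Longrightarrow> 0 \<le> v x" "\<And>x. x \<in> L \<Longrightarrow> v x \<le> C * \<sigma> x" and C: "0 \<le> C"
  shows wsummable_conv_power_dominated: "wsummable v (conv_power r k)"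
    and wnorm_conv_power_dominated_le:
      "wnorm v (conv_power r k) \<le> C * (norm one * \<sigma> 0 * (mul_bound * wnorm \<sigma> r) ^ k)"
proof -
  show "wsummable v (conv_power r k)"
    by (rule wsummable_mono_weight[OF wsummable_conv_power[OF \<sigma> r] v])
  have "wnorm v (conv_power r k) \<le> C * wnorm \<sigma> (conv_power r k)"
    by (rule wnorm_mono_weight[OF wsummable_conv_power[OF \<sigma> r] v])
  also have "\<dots> \<le> C * (norm one * \<sigma> 0 * (mul_bound * wnorm \<sigma> r) ^ k)"
    using wnorm_conv_power_le[OF \<sigma> r] C by (rule mult_left_mono)
  finally show "wnorm v (conv_power r k) \<le> C * (norm one * \<sigma> 0 * (mul_bound * wnorm \<sigma> r) ^ k)" .
qed

lemma conv_conv_power_tendsto_zero: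
  assumes \<sigma>: "nonneg_submultiplicative_on L \<sigma>" "\<And>x. x \<in> L \<Longrightarrow> 1 \<le> C * \<sigma> x" and C: "0 \<le> C"
    and r: "l1 r" "wsummable \<sigma> r" "mul_bound * wnorm \<sigma> r < 1" and e: "l1 e"
  shows "(\<lambda>N. conv e (conv_power r N) v) \<longlonglongrightarrow> 0"
proof (rule Lim_null_comparison)
  define q where "q = mul_bound * wnorm \<sigma> r"
  have q: "0 \<le> q" "q < 1"
    using r(3) \<sigma>(1) mul_bound_pos wnorm_nonneg[of \<sigma> r]
    by (auto simp: q_def nonneg_submultiplicative_on_def)
  define B where "B = mul_bound * norm1 e * (C * (norm one * \<sigma> 0))"
  have e_bound: "0 \<le> mul_bound * norm1 e"
    using mul_bound_pos wnorm_nonneg[of "\<lambda>_. 1" e] by simp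
  show "(\<lambda>N. B * q ^ N) \<longlonglongrightarrow> 0"
    using q by (intro tendsto_mult_right_zero LIMSEQ_power_zero) auto
  have "norm (conv e (conv_power r N) v) \<le> B * q ^ N" for N
  proof (cases "v \<in> L")
    case False
    have "0 \<le> norm one * (C * \<sigma> 0)"
      using \<sigma>(2)[OF exp_semigroup_zero[OF exp_semigroup]] by simp
    then have "0 \<le> B"
      using e_bound by (simp add: B_def mult.left_commute[of C "norm one"])
    with False q show ?thesis
      using supported_conv[unfolded supported_def] by simp
  next
    case True
    have power: "l1 (conv_power r N)"
      using l1_conv_power[OF nonneg_submultiplicative_on_const_1 r(1) r(1)] .
    have "norm (conv e (conv_power r N) v) \<le> norm1 (conv e (conv_power r N))"
      using nonneg_submultiplicative_on_const_1 e power True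
      by (intro norm_le_norm1 wsummable_conv) auto
    also have "\<dots> \<le> mul_bound * norm1 e * norm1 (conv_power r N)"
      using nonneg_submultiplicative_on_const_1 e power by (intro wnorm_conv_le) auto
    also have "\<dots> \<le> mul_bound * norm1 e * (C * (norm one * \<sigma> 0 * q ^ N))"
      using wnorm_conv_power_dominated_le[OF \<sigma>(1) r(1,2) _ \<sigma>(2) C] e_bound
      unfolding q_def by (intro mult_left_mono) auto
    also have "\<dots> = B * q ^ N"
      by (simp add: B_def mult_ac)
    finally show ?thesis .
  qed
  then show "eventually (\<lambda>N. norm (conv e (conv_power r N) v) \<le> B * q ^ N) sequentially"
    by simp
qed

lemma
  assumes w: "nonneg_submultiplicative_on L w"
    and \<sigma>: "nonneg_submultiplicative_on L \<sigma>" "\<And>x. x \<in> L \<Longrightarrow> w x \<le> C * \<sigma> x" and C: "0 \<le> C"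
    and r: "l1 r" "wsummable \<sigma> r" and g: "l1 g" "wsummable w g"
  shows wsummable_conv_conv_power: "wsummable w (conv g (conv_power r k))"
    and wnorm_conv_conv_power_le: "wnorm w (conv g (conv_power r k))
      \<le> mul_bound * wnorm w g * (C * (norm one * \<sigma> 0)) * (mul_bound * wnorm \<sigma> r) ^ k"
proof -
  have w_nonneg: "0 \<le> w x" if "x \<in> L" for x
    using w that by (simp add: nonneg_submultiplicative_on_def)
  have power: "l1 (conv_power r k)"
    using l1_conv_power[OF nonneg_submultiplicative_on_const_1 r(1) r(1)] .
  note power_w = wsummable_conv_power_dominated[OF \<sigma>(1) r w_nonneg \<sigma>(2) C]
    wnorm_conv_power_dominated_le[OF \<sigma>(1) r w_nonneg \<sigma>(2) C]
  show "wsummable w (conv g (conv_power r k))"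
    using wsummable_conv[OF w g power power_w(1)] .
  have "wnorm w (conv g (conv_power r k)) \<le> mul_bound * wnorm w g * wnorm w (conv_power r k)"
    using wnorm_conv_le[OF w g power power_w(1)] .
  also have "\<dots> \<le> mul_bound * wnorm w g * (C * (norm one * \<sigma> 0 * (mul_bound * wnorm \<sigma> r) ^ k))"
    using power_w(2) mul_bound_pos wnorm_nonneg[of w g] w_nonneg by (intro mult_left_mono) auto
  finally show "wnorm w (conv g (conv_power r k))
      \<le> mul_bound * wnorm w g * (C * (norm one * \<sigma> 0)) * (mul_bound * wnorm \<sigma> r) ^ k"
    by (simp add: mult_ac)
qed

section \<open>Inverse closedness\<close>

lemma conv_left_inverse_remainder:
  assumes c: "l1 c" and e: "supported e" "l1 e" and ec: "conv e c = dunit one"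
    and g: "supported g" "l1 g"
  shows "conv e (\<lambda>x. dunit one x - conv c g x) = (\<lambda>x. e x - g x)"
proof -
  have cg: "l1 (conv c g)"
    using c g(2) nonneg_submultiplicative_on_const_1 by (intro wsummable_conv) auto
  have "conv e (conv c g) = g"
    using conv_assoc[OF e(2) c g(2)] ec conv_dunit_left[OF g(1)] by simp
  then show ?thesis
    using conv_diff_right[OF e(2) wsummable_dunit cg] conv_dunit_right[OF e(1)] by simp
qed

lemma finite_approximate_inverse:
  assumes c: "l1 c" and e: "supported e" "l1 e"
    and ce: "conv c e = dunit one" and ec: "conv e c = dunit one" and \<epsilon>: "0 < \<epsilon>"
  obtains g where "\<And>w. wsummable w g"
    and "norm1 (\<lambda>x. dunit one x - conv c g x) \<le> \<epsilon>"
    and "conv e (\<lambda>x. dunit one x - conv c g x) = (\<lambda>x. e x - g x)"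
proof -
  define \<eta> where "\<eta> = \<epsilon> / (mul_bound * (norm1 c + 1))"
  have c_pos: "0 \<le> norm1 c"
    by (rule wnorm_nonneg) simp
  then have "0 < \<eta>"
    using \<epsilon> mul_bound_pos by (simp add: \<eta>_def)
  then obtain G where G: "finite G" "G \<subseteq> L" and tail: "norm1 (\<lambda>x. if x \<in> G then 0 else e x) \<le> \<eta>"
    using wnorm_tail_small[OF _ e(2)] by auto
  define g where "g x = (if x \<in> G then e x else 0)" for x
  have g: "wsummable w g" for w
    using G by (intro wsummable_finite_support) (auto simp: g_def elim: finite_subset[rotated])
  have g_supported: "supported g"
    using G by (auto simp: supported_def g_def)
  have e_minus_g: "(\<lambda>x. e x - g x) = (\<lambda>x. if x \<in> G then 0 else e x)"
    by (auto simp: g_def)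
  have "l1 (\<lambda>x. e x - g x)"
    using e(2) g by (intro wsummable_diff) auto
  have "(\<lambda>x. dunit one x - conv c g x) = conv c (\<lambda>x. e x - g x)"
    using conv_diff_right[OF c e(2) g] ce by simp
  then have "norm1 (\<lambda>x. dunit one x - conv c g x) \<le> mul_bound * norm1 c * norm1 (\<lambda>x. e x - g x)"
    using c \<open>l1 (\<lambda>x. e x - g x)\<close> nonneg_submultiplicative_on_const_1 by (simp add: wnorm_conv_le)
  also have "\<dots> \<le> mul_bound * (norm1 c + 1) * \<eta>"
    using tail c_pos mul_bound_pos wnorm_nonneg[of "\<lambda>_. 1" "\<lambda>x. e x - g x"] unfolding e_minus_g
    by (intro mult_mono) auto
  also have "\<dots> = \<epsilon>"
    using c_pos mul_bound_pos by (simp add: \<eta>_def)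
  finally show ?thesis
    using that g conv_left_inverse_remainder[OF c e ec g_supported g] by blast
qed

lemma wnorm_le_tail_plus_norm1:
  assumes \<sigma>: "\<And>x. x \<in> L \<Longrightarrow> 0 \<le> \<sigma> x" "\<And>x. x \<in> L \<Longrightarrow> \<sigma> x \<le> w x"
    and F: "\<And>x. x \<in> F \<Longrightarrow> \<sigma> x \<le> \<rho>" and \<rho>: "0 \<le> \<rho>" and r: "wsummable w r" "l1 r"
  shows "wnorm \<sigma> r \<le> wnorm w (\<lambda>x. if x \<in> F then 0 else r x) + \<rho> * norm1 r"
proof -
  let ?tail = "\<lambda>x. if x \<in> F then 0 else r x"
  have w_nonneg: "0 \<le> w x" if "x \<in> L" for x
    using \<sigma>[OF that] by linarith
  have "wsummable w ?tail"
    unfolding wsummable_def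
    by (rule summable_on_comparison_test[OF r(1)[unfolded wsummable_def]]) (auto simp: w_nonneg)
  with r(2) have sum: "((\<lambda>x. norm (?tail x) * w x + \<rho> * (norm (r x) * 1)) has_sum
      (wnorm w ?tail + \<rho> * norm1 r)) L"
    unfolding wsummable_def wnorm_def by (intro has_sum_add has_sum_cmult_right) auto
  have pointwise: "norm (r x) * \<sigma> x \<le> norm (?tail x) * w x + \<rho> * (norm (r x) * 1)" if "x \<in> L" for x
  proof (cases "x \<in> F")
    case True
    then show ?thesis
      using F[OF True] mult_left_mono[of "\<sigma> x" \<rho> "norm (r x)"] by (simp add: mult.commute)
  next
    case False
    then show ?thesis
      using \<sigma>[OF that] \<rho> mult_left_mono[of "\<sigma> x" "w x" "norm (r x)"] by (simp add: add_increasing2)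
  qed
  have "wsummable \<sigma> r"
    using wsummable_mono_weight[OF r(1), of \<sigma> 1] \<sigma> by auto
  then show ?thesis
    unfolding wnorm_def[of \<sigma>] using pointwise
    by (intro has_sum_mono[OF has_sum_infsum sum]) (auto simp: wsummable_def)
qed

lemma renormed_wnorm_le:
  assumes w: "admissible_weight L w" and r: "wsummable w r" and \<epsilon>: "0 < \<epsilon>"
  obtains \<sigma> C where "nonneg_submultiplicative_on L \<sigma>" and "\<And>x. x \<in> L \<Longrightarrow> w x \<le> C * \<sigma> x"
    and "wsummable \<sigma> r" and "wnorm \<sigma> r \<le> \<epsilon> + 2 * norm1 r"
proof -
  note weight = admissible_weight_imp_weight_on[OF w]
  have w_nonneg: "0 \<le> w x" if "x \<in> L" for x
    using weight_on_ge_1[OF weight that] by simp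
  obtain F where F: "finite F" "F \<subseteq> L" and tail: "wnorm w (\<lambda>x. if x \<in> F then 0 else r x) \<le> \<epsilon>"
    using wnorm_tail_small[OF w_nonneg r \<epsilon>] by blast
  define \<sigma> where "\<sigma> = renormed_weight L w 2 F"
  obtain C where C: "\<And>x. x \<in> L \<Longrightarrow> w x \<le> C * \<sigma> x"
    using weight_le_renormed_weight[OF exp_semigroup w _ F] unfolding \<sigma>_def by force
  have \<sigma>: "nonneg_submultiplicative_on L \<sigma>"
    using nonneg_submultiplicative_renormed_weight[OF exp_semigroup w _ F] by (simp add: \<sigma>_def)
  have \<sigma>_le: "\<sigma> x \<le> w x" if "x \<in> L" for x
    using renormed_weight_le_weight[OF exp_semigroup w _ F that] by (simp add: \<sigma>_def)
  have \<sigma>_nonneg: "0 \<le> \<sigma> x" if "x \<in> L" for x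
    using \<sigma> that by (simp add: nonneg_submultiplicative_on_def)
  have "wnorm \<sigma> r \<le> wnorm w (\<lambda>x. if x \<in> F then 0 else r x) + 2 * norm1 r"
    using renormed_weight_le_base[OF exp_semigroup w _ F, where \<rho> = 2] wsummable_imp_l1[OF weight r]
    by (intro wnorm_le_tail_plus_norm1[OF \<sigma>_nonneg \<sigma>_le _ _ r]) (auto simp: \<sigma>_def)
  moreover have "wsummable \<sigma> r"
    using wsummable_mono_weight[OF r, of \<sigma> 1] \<sigma>_nonneg \<sigma>_le by auto
  ultimately show ?thesis
    using that \<sigma> C tail by fastforce
qed

lemma wsummable_if_contractive_remainder:
  assumes w: "weight_on L w"
    and \<sigma>: "nonneg_submultiplicative_on L \<sigma>" "\<And>x. x \<in> L \<Longrightarrow> w x \<le> C * \<sigma> x"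
    and r: "l1 r" "wsummable \<sigma> r" "mul_bound * wnorm \<sigma> r < 1"
    and g: "wsummable w g"
    and e: "supported e" "l1 e" "conv e r = (\<lambda>x. e x - g x)"
  shows "wsummable w e"
proof -
  define q where "q = mul_bound * wnorm \<sigma> r"
  have q: "0 \<le> q" "q < 1"
    using r(3) \<sigma>(1) mul_bound_pos wnorm_nonneg[of \<sigma> r]
    by (auto simp: q_def nonneg_submultiplicative_on_def)
  have w_nonneg: "0 \<le> w x" if "x \<in> L" for x
    using weight_on_ge_1[OF w that] by simp
  have w_sub: "nonneg_submultiplicative_on L w"
    using weight_on_imp_nonneg_submultiplicative_on[OF w] .
  have g1: "l1 g"
    using wsummable_imp_l1[OF w g] .
  have \<sigma>0: "0 \<le> \<sigma> 0"
    using \<sigma>(1) exp_semigroup_zero[OF exp_semigroup] by (simp add: nonneg_submultiplicative_on_def)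
  have C: "0 \<le> C"
    using \<sigma>(2)[OF exp_semigroup_zero[OF exp_semigroup]] \<sigma>0 weight_on_zero[OF w]
    by (smt (verit) mult_nonpos_nonneg)
  define M where "M = mul_bound * wnorm w g * (C * (norm one * \<sigma> 0))"
  have geometric: "wnorm w (conv g (conv_power r k)) \<le> M * q ^ k" for k
    using wnorm_conv_conv_power_le[OF w_sub \<sigma> C r(1,2) g1 g] unfolding M_def q_def .
  show ?thesis
  proof (rule wsummable_of_series[where a = "\<lambda>k. conv g (conv_power r k)" and M = "M / (1 - q)"])
    show "0 \<le> w x" if "x \<in> L" for x
      using w_nonneg[OF that] .
    have one_le: "1 \<le> C * \<sigma> x" if "x \<in> L" for x
      using weight_on_ge_1[OF w that] \<sigma>(2)[OF that] by simp
    have "(\<lambda>N. e v - conv e (conv_power r N) v) \<longlonglongrightarrow> e v - 0" for v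
      by (intro tendsto_diff tendsto_const conv_conv_power_tendsto_zero[OF \<sigma>(1) one_le C r e(2)])
    then show "(\<lambda>N. \<Sum>k<N. conv g (conv_power r k) v) \<longlonglongrightarrow> e v" for v
      by (simp add: conv_telescope[OF e(1,2) g1 r(1) e(3)])
    show "wsummable w (conv g (conv_power r k))" for k
      using wsummable_conv_conv_power[OF w_sub \<sigma> C r(1,2) g1 g] .
    have "0 \<le> M"
      using mul_bound_pos wnorm_nonneg[of w g] w_nonneg C \<sigma>0 by (simp add: M_def)
    then show "(\<Sum>k<N. wnorm w (conv g (conv_power r k))) \<le> M / (1 - q)" for N
      by (rule sum_le_geometric_bound[OF geometric _ q])
  qed
qed

theorem wsummable_inverse:
  assumes w: "admissible_weight L w" and c: "wsummable w c" and e: "supported e" "l1 e"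
    and ce: "conv c e = dunit one" and ec: "conv e c = dunit one"
  shows "wsummable w e"
proof -
  note weight = admissible_weight_imp_weight_on[OF w]
  define \<epsilon> where "\<epsilon> = 1 / (4 * mul_bound)"
  have \<epsilon>: "0 < \<epsilon>"
    using mul_bound_pos by (simp add: \<epsilon>_def)
  obtain g where g: "\<And>w. wsummable w g"
    and small: "norm1 (\<lambda>x. dunit one x - conv c g x) \<le> \<epsilon>"
    and er: "conv e (\<lambda>x. dunit one x - conv c g x) = (\<lambda>x. e x - g x)"
    using finite_approximate_inverse[OF wsummable_imp_l1[OF weight c] e ce ec \<epsilon>] by blast
  define r where "r = (\<lambda>x. dunit one x - conv c g x)"
  have w_nonneg: "0 \<le> w x" if "x \<in> L" for x
    using weight_on_ge_1[OF weight that] by simp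
  have "wsummable w (conv c g)"
    using weight_on_imp_nonneg_submultiplicative_on[OF weight] wsummable_imp_l1[OF weight] c g
    by (intro wsummable_conv) auto
  then have r_w: "wsummable w r"
    unfolding r_def using wsummable_dunit w_nonneg by (intro wsummable_diff)
  obtain \<sigma> C where \<sigma>: "nonneg_submultiplicative_on L \<sigma>" "\<And>x. x \<in> L \<Longrightarrow> w x \<le> C * \<sigma> x"
    and r_\<sigma>: "wsummable \<sigma> r" "wnorm \<sigma> r \<le> \<epsilon> + 2 * norm1 r"
    using renormed_wnorm_le[OF w r_w \<epsilon>] by blast
  have "mul_bound * wnorm \<sigma> r \<le> mul_bound * (3 * \<epsilon>)"
    using r_\<sigma>(2) small mul_bound_pos unfolding r_def by (intro mult_left_mono) auto
  then have contractive: "mul_bound * wnorm \<sigma> r < 1"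
    using mul_bound_pos by (simp add: \<epsilon>_def)
  have "conv e r = (\<lambda>x. e x - g x)"
    using er by (simp add: r_def)
  then show ?thesis
    by (intro wsummable_if_contractive_remainder[of w \<sigma> C r g e])
       (use weight \<sigma> wsummable_imp_l1[OF weight r_w] r_\<sigma>(1) contractive g e in auto)
qed

end

definition norm_equivalent :: "('a::real_normed_vector \<Rightarrow> real) \<Rightarrow> bool" where
  "norm_equivalent N \<longleftrightarrow> (\<exists>a>0. \<exists>b. \<forall>x. a * norm x \<le> N x \<and> N x \<le> b * norm x)"

lemma summable_on_norm_equivalent_iff:
  assumes N: "norm_equivalent N" and v: "\<And>x. x \<in> A \<Longrightarrow> 0 \<le> v x"
  shows "(\<lambda>x. N (f x) * v x) summable_on A \<longleftrightarrow> (\<lambda>x. norm (f x) * v x) summable_on A"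
proof -
  obtain a b where a: "0 < a" and lower: "\<And>x. a * norm x \<le> N x" and upper: "\<And>x. N x \<le> b * norm x"
    using N by (auto simp: norm_equivalent_def)
  have N_nonneg: "0 \<le> N x" for x
    using lower[of x] a by (meson mult_nonneg_nonneg less_imp_le norm_ge_zero order.trans)
  show ?thesis
  proof
    assume "(\<lambda>x. N (f x) * v x) summable_on A"
    then have bound: "(\<lambda>x. inverse a * (N (f x) * v x)) summable_on A"
      by (rule summable_on_cmult_right)
    have "norm (f x) * v x \<le> inverse a * (N (f x) * v x)" if "x \<in> A" for x
      using mult_right_mono[OF lower[of "f x"] v[OF that]] a by (simp add: field_simps)
    then show "(\<lambda>x. norm (f x) * v x) summable_on A"
      by (intro summable_on_comparison_test[OF bound]) (use v in auto)
  next
    assume "(\<lambda>x. norm (f x) * v x) summable_on A"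
    then have bound: "(\<lambda>x. b * (norm (f x) * v x)) summable_on A"
      by (rule summable_on_cmult_right)
    have "N (f x) * v x \<le> b * (norm (f x) * v x)" if "x \<in> A" for x
      using mult_right_mono[OF upper[of "f x"] v[OF that]] by (simp add: mult.assoc)
    then show "(\<lambda>x. N (f x) * v x) summable_on A"
      by (intro summable_on_comparison_test[OF bound]) (use v N_nonneg in auto)
  qed
qed

lemma (in unital_bounded_algebra) inverse_closed_if_norm_equivalent:
  assumes L: "exp_semigroup L" and w: "admissible_weight L w" and N: "norm_equivalent N"
  shows "inverse_closed mul one N L w"
proof -
  interpret dirichlet_algebra mul one L
    by (intro dirichlet_algebra.intro unital_bounded_algebra_axioms dirichlet_algebra_axioms.intro L)
  have Dset_eq: "Dset N L v = {f. supported f \<and> wsummable v f}" if "\<forall>x\<in>L. 0 \<le> v x" for v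
    using summable_on_norm_equivalent_iff[OF N, where A = L and v = v] that
    by (auto simp: Dset_def supported_def wsummable_def)
  have w_nonneg: "\<forall>x\<in>L. 0 \<le> w x"
    using weight_on_ge_1[OF admissible_weight_imp_weight_on[OF w]] by (auto intro: order.trans[OF zero_le_one])
  show ?thesis
    unfolding inverse_closed_def Dset_eq[OF w_nonneg] Dset_eq[of "\<lambda>_. 1", simplified]
    by (auto intro: wsummable_inverse[OF w])
qed

section \<open>The coefficient algebras\<close>

lemma norm_equivalent_add_fst_snd:
  assumes "norm_equivalent N1" and "norm_equivalent N2"
  shows "norm_equivalent (\<lambda>x. N1 (fst x) + N2 (snd x))"
proof -
  obtain a1 b1 where a1: "0 < a1" and ab1: "\<And>x. a1 * norm x \<le> N1 x \<and> N1 x \<le> b1 * norm x"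
    using assms(1) by (auto simp: norm_equivalent_def)
  obtain a2 b2 where a2: "0 < a2" and ab2: "\<And>x. a2 * norm x \<le> N2 x \<and> N2 x \<le> b2 * norm x"
    using assms(2) by (auto simp: norm_equivalent_def)
  have lower: "min a1 a2 * norm x \<le> N1 (fst x) + N2 (snd x)" for x :: "'a \<times> 'b"
  proof -
    have "min a1 a2 * norm x \<le> min a1 a2 * (norm (fst x) + norm (snd x))"
      using norm_Pair_le[of "fst x" "snd x"] a1 a2 by (intro mult_left_mono) auto
    also have "\<dots> \<le> a1 * norm (fst x) + a2 * norm (snd x)"
      by (simp add: distrib_left add_mono mult_right_mono)
    also have "\<dots> \<le> N1 (fst x) + N2 (snd x)"
      using ab1 ab2 by (simp add: add_mono)
    finally show ?thesis .
  qed
  have upper: "N1 (fst x) + N2 (snd x) \<le> (\<bar>b1\<bar> + \<bar>b2\<bar>) * norm x" for x :: "'a \<times> 'b"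
  proof -
    have "N1 (fst x) + N2 (snd x) \<le> \<bar>b1\<bar> * norm (fst x) + \<bar>b2\<bar> * norm (snd x)"
      using ab1[of "fst x"] ab2[of "snd x"]
      by (smt (verit) abs_ge_self mult_right_mono norm_ge_zero)
    also have "\<dots> \<le> \<bar>b1\<bar> * norm x + \<bar>b2\<bar> * norm x"
      using norm_fst_le[of "fst x" "snd x"] norm_snd_le[of "snd x" "fst x"]
      by (intro add_mono mult_left_mono) auto
    finally show ?thesis
      by (simp add: distrib_right)
  qed
  show ?thesis
    unfolding norm_equivalent_def
    by (intro exI[of _ "min a1 a2"] conjI exI[of _ "\<bar>b1\<bar> + \<bar>b2\<bar>"] allI) (use a1 a2 lower upper in auto)
qed

lemma unital_bounded_algebra_prod:
  fixes p :: "'a::euclidean_space \<Rightarrow> 'a \<Rightarrow> 'a" and q :: "'b::euclidean_space \<Rightarrow> 'b \<Rightarrow> 'b"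
  assumes "unital_bounded_algebra p one" and "unital_bounded_algebra q one'"
  shows "unital_bounded_algebra (\<lambda>x y. (p (fst x) (fst y), q (snd x) (snd y))) (one, one')"
proof -
  interpret p: unital_bounded_algebra p one by fact
  interpret q: unital_bounded_algebra q one' by fact
  have "bilinear (\<lambda>x y :: 'a \<times> 'b. (p (fst x) (fst y), q (snd x) (snd y)))"
    by (simp add: bilinear_def linear_iff p.add_left p.add_right q.add_left q.add_right
        p.scaleR_left p.scaleR_right q.scaleR_left q.scaleR_right)
  then show ?thesis
    by (intro unital_bounded_algebra.intro unital_bounded_algebra_axioms.intro)
       (auto simp: bilinear_conv_bounded_bilinear p.mul_assoc q.mul_assoc p.mul_one_left q.mul_one_left
         p.mul_one_right q.mul_one_right)
qed

definition matmul :: "('a \<Rightarrow> 'a \<Rightarrow> 'a::comm_monoid_add) \<Rightarrow> 'a^'n::finite^'n \<Rightarrow> 'a^'n^'n \<Rightarrow> 'a^'n^'n" where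
  "matmul p A B = (\<chi> i j. \<Sum>k\<in>UNIV. p (A$i$k) (B$k$j))"

definition matvec :: "('a \<Rightarrow> 'a \<Rightarrow> 'a::comm_monoid_add) \<Rightarrow> 'a^'n::finite^'n \<Rightarrow> 'a^'n \<Rightarrow> 'a^'n" where
  "matvec p A x = (\<chi> i. \<Sum>j\<in>UNIV. p (A$i$j) (x$j))"

definition matone :: "'a::zero \<Rightarrow> 'a^'n::finite^'n" where
  "matone one = (\<chi> i j. if i = j then one else 0)"

lemma norm_vec_le_sum_norm: "norm (x :: 'a::real_normed_vector^'n) \<le> (\<Sum>i\<in>UNIV. norm (x$i))"
  by (simp add: norm_vec_def L2_set_le_sum)

lemma unital_bounded_algebra_matmul:
  fixes p :: "'a::euclidean_space \<Rightarrow> 'a \<Rightarrow> 'a"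
  assumes "unital_bounded_algebra p one"
  shows "unital_bounded_algebra (matmul p :: 'a^'n::finite^'n \<Rightarrow> _) (matone one)"
proof -
  interpret p: unital_bounded_algebra p one by fact
  have "bilinear (matmul p :: 'a^'n^'n \<Rightarrow> _)"
    by (simp add: bilinear_def linear_iff matmul_def vec_eq_iff p.add_left p.add_right
        p.scaleR_left p.scaleR_right sum.distrib scaleR_sum_right)
  moreover have "matmul p (matmul p A B) C = matmul p A (matmul p B C)" for A B C :: "'a^'n^'n"
  proof -
    have "(\<Sum>l\<in>UNIV. p (\<Sum>k\<in>UNIV. p (A$i$k) (B$k$l)) (C$l$j))
        = (\<Sum>k\<in>UNIV. p (A$i$k) (\<Sum>l\<in>UNIV. p (B$k$l) (C$l$j)))" for i j
      unfolding p.sum_left p.sum_right p.mul_assoc by (rule sum.swap)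
    then show ?thesis
      by (simp add: matmul_def vec_eq_iff)
  qed
  moreover have "matmul p (matone one) A = A" and "matmul p A (matone one) = A" for A :: "'a^'n^'n"
    by (simp_all add: matmul_def matone_def vec_eq_iff if_distrib if_distribR p.zero_left p.zero_right
        p.mul_one_left p.mul_one_right cong: if_cong)
  ultimately show ?thesis
    by (intro unital_bounded_algebra.intro unital_bounded_algebra_axioms.intro)
       (auto simp: bilinear_conv_bounded_bilinear)
qed

lemma bounded_bilinear_matvec:
  fixes p :: "'a::euclidean_space \<Rightarrow> 'a \<Rightarrow> 'a"
  assumes "bounded_bilinear p"
  shows "bounded_bilinear (matvec p :: 'a^'n::finite^'n \<Rightarrow> _)"
proof -
  interpret p: bounded_bilinear p by fact
  have "bilinear (matvec p :: 'a^'n^'n \<Rightarrow> _)"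
    by (simp add: bilinear_def linear_iff matvec_def vec_eq_iff p.add_left p.add_right
        p.scaleR_left p.scaleR_right sum.distrib scaleR_sum_right)
  then show ?thesis
    by (simp add: bilinear_conv_bounded_bilinear)
qed

lemma norm_entry_le_onorm_matvec:
  fixes p :: "'a::euclidean_space \<Rightarrow> 'a \<Rightarrow> 'a" and A :: "'a^'n::finite^'n"
  assumes p: "bounded_bilinear p" and one: "\<And>x. p x one = x"
  shows "norm (A$i$j) \<le> norm one * onorm (matvec p A)"
proof -
  interpret mv: bounded_bilinear "matvec p :: 'a^'n^'n \<Rightarrow> _"
    using bounded_bilinear_matvec[OF p] .
  have "matvec p A (axis j one) $ i = A$i$j"
    by (simp add: matvec_def axis_def if_distrib bounded_bilinear.zero_right[OF p] one cong: if_cong)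
  then have "norm (A$i$j) \<le> norm (matvec p A (axis j one))"
    using Finite_Cartesian_Product.norm_nth_le[of "matvec p A (axis j one)" i] by simp
  also have "\<dots> \<le> onorm (matvec p A) * norm (axis j one)"
    by (rule onorm[OF mv.bounded_linear_right])
  also have "norm (axis j one) = norm one"
    by (simp add: norm_eq_sqrt_inner inner_axis_axis)
  finally show ?thesis
    by (simp add: mult.commute)
qed

lemma norm_equivalent_onorm_matvec:
  fixes p :: "'a::euclidean_space \<Rightarrow> 'a \<Rightarrow> 'a"
  assumes p: "bounded_bilinear p" and one: "\<And>x. p x one = x"
  shows "norm_equivalent (\<lambda>A :: 'a^'n::finite^'n. onorm (matvec p A))"
proof -
  interpret mv: bounded_bilinear "matvec p :: 'a^'n^'n \<Rightarrow> _"
    using bounded_bilinear_matvec[OF p] .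
  obtain K where K: "0 \<le> K" "\<And>(A :: 'a^'n^'n) x. norm (matvec p A x) \<le> norm A * norm x * K"
    using mv.nonneg_bounded by auto
  have upper: "onorm (matvec p A) \<le> K * norm A" for A :: "'a^'n^'n"
    using K by (intro onorm_bound) (auto simp: mult_ac)
  define c where "c = real CARD('n) * real CARD('n) * norm one + 1"
  have lower: "norm A \<le> c * onorm (matvec p A)" for A :: "'a^'n^'n"
  proof -
    have "norm A \<le> (\<Sum>i\<in>UNIV. \<Sum>j\<in>UNIV. norm (A$i$j))"
      by (rule order.trans[OF norm_vec_le_sum_norm sum_mono[OF norm_vec_le_sum_norm]])
    also have "\<dots> \<le> (\<Sum>i\<in>(UNIV::'n set). \<Sum>j\<in>(UNIV::'n set). norm one * onorm (matvec p A))"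
      by (intro sum_mono norm_entry_le_onorm_matvec[OF p one])
    also have "\<dots> \<le> c * onorm (matvec p A)"
      using onorm_pos_le[OF mv.bounded_linear_right] by (simp add: c_def algebra_simps)
    finally show ?thesis .
  qed
  have "0 < c"
    by (simp add: c_def add_nonneg_pos)
  then have "inverse c * norm A \<le> onorm (matvec p A)" for A :: "'a^'n^'n"
    using lower[of A] by (simp add: field_simps)
  with upper \<open>0 < c\<close> show ?thesis
    unfolding norm_equivalent_def by (intro exI[of _ "inverse c"] conjI exI[of _ K] allI) auto
qed

lemma unital_bounded_algebra_complex: "unital_bounded_algebra (*) (1::complex)"
  by (intro unital_bounded_algebra.intro unital_bounded_algebra_axioms.intro bounded_bilinear_mult)
     (simp_all add: mult.assoc)

lemma unital_bounded_algebra_cmat: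
  "unital_bounded_algebra ((**) :: complex^'n::finite^'n \<Rightarrow> _) (mat 1)"
proof -
  have "((**) :: complex^'n^'n \<Rightarrow> _) = matmul (*)" and "(mat 1 :: complex^'n^'n) = matone 1"
    by (intro ext, simp add: matmul_def matrix_matrix_mult_def) (simp add: matone_def mat_def)
  then show ?thesis
    using unital_bounded_algebra_matmul[OF unital_bounded_algebra_complex] by metis
qed

lemma norm_equivalent_cmat_norm: "norm_equivalent (cmat_norm :: complex^'n::finite^'n \<Rightarrow> real)"
proof -
  have "(\<lambda>x. A *v x) = matvec (*) A" for A :: "complex^'n^'n"
    by (intro ext) (simp add: matvec_def matrix_vector_mult_def)
  then have "cmat_norm = (\<lambda>A :: complex^'n^'n. onorm (matvec (*) A))"
    by (simp add: cmat_norm_def[abs_def])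
  then show ?thesis
    using norm_equivalent_onorm_matvec[OF bounded_bilinear_mult mult_1_right] by metis
qed

lemma unital_bounded_algebra_bcmat:
  "unital_bounded_algebra (bcmat_mult :: (complex^'n::finite^'n) \<times> (complex^'n^'n) \<Rightarrow> _) bcmat_one"
  using unital_bounded_algebra_prod[OF unital_bounded_algebra_cmat unital_bounded_algebra_cmat]
  by (simp add: bcmat_mult_def[abs_def] bcmat_one_def)

lemma norm_equivalent_bcmat_norm:
  "norm_equivalent (bcmat_norm :: (complex^'n::finite^'n) \<times> (complex^'n^'n) \<Rightarrow> real)"
  using norm_equivalent_add_fst_snd[OF norm_equivalent_cmat_norm norm_equivalent_cmat_norm]
  by (simp add: bcmat_norm_def[abs_def])

lemma qmult_nth:
  "qmult p q $ 1 = p$1 * q$1 - p$2 * q$2 - p$3 * q$3 - p$4 * q$4"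
  "qmult p q $ 2 = p$1 * q$2 + p$2 * q$1 + p$3 * q$4 - p$4 * q$3"
  "qmult p q $ 3 = p$1 * q$3 - p$2 * q$4 + p$3 * q$1 + p$4 * q$2"
  "qmult p q $ 4 = p$1 * q$4 + p$2 * q$3 - p$3 * q$2 + p$4 * q$1"
  by (simp_all add: qmult_def vector_def)

lemma qone_nth: "qone $ 1 = 1" "qone $ 2 = 0" "qone $ 3 = 0" "qone $ 4 = 0"
  by (simp_all add: qone_def vector_def)

lemma unital_bounded_algebra_quaternion: "unital_bounded_algebra qmult qone"
proof -
  have "bilinear qmult"
    by (simp add: bilinear_def linear_iff vec_eq_iff forall_4 qmult_nth algebra_simps)
  then show ?thesis
    by (intro unital_bounded_algebra.intro unital_bounded_algebra_axioms.intro)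
       (simp_all add: bilinear_conv_bounded_bilinear vec_eq_iff forall_4 qmult_nth qone_nth algebra_simps)
qed

lemma unital_bounded_algebra_hmat:
  "unital_bounded_algebra (hmat_mult :: (real^4)^'n::finite^'n \<Rightarrow> _) hmat_one"
proof -
  have "(hmat_mult :: (real^4)^'n^'n \<Rightarrow> _) = matmul qmult" and "(hmat_one :: (real^4)^'n^'n) = matone qone"
    by (intro ext, simp add: matmul_def hmat_mult_def) (simp add: matone_def hmat_one_def)
  then show ?thesis
    using unital_bounded_algebra_matmul[OF unital_bounded_algebra_quaternion] by metis
qed

lemma norm_equivalent_hmat_norm: "norm_equivalent (hmat_norm :: (real^4)^'n::finite^'n \<Rightarrow> real)"
proof -
  interpret q: unital_bounded_algebra qmult qone
    by (rule unital_bounded_algebra_quaternion)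
  have "hmat_norm = (\<lambda>A :: (real^4)^'n^'n. onorm (matvec qmult A))"
    by (simp add: hmat_norm_def[abs_def] hmat_vec_def[abs_def] matvec_def[abs_def])
  then show ?thesis
    using norm_equivalent_onorm_matvec[OF q.bounded_bilinear_axioms q.mul_one_right] by metis
qed

theorem mainTheorem10:
  fixes \<Lambda> :: "real set" and \<omega> :: "real \<Rightarrow> real"
  assumes "exp_semigroup \<Lambda>"
    and "admissible_weight \<Lambda> \<omega>"
  shows "inverse_closed (**) (mat 1 :: complex^'n::finite^'n) cmat_norm \<Lambda> \<omega>
       \<and> inverse_closed bcmat_mult (bcmat_one :: (complex^'n^'n) \<times> (complex^'n^'n)) bcmat_norm \<Lambda> \<omega>
       \<and> inverse_closed hmat_mult (hmat_one :: (real^4)^'n^'n) hmat_norm \<Lambda> \<omega>"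
proof (intro conjI)
  show "inverse_closed (**) (mat 1 :: complex^'n^'n) cmat_norm \<Lambda> \<omega>"
    by (rule unital_bounded_algebra.inverse_closed_if_norm_equivalent
        [OF unital_bounded_algebra_cmat assms norm_equivalent_cmat_norm])
  show "inverse_closed bcmat_mult (bcmat_one :: (complex^'n^'n) \<times> (complex^'n^'n)) bcmat_norm \<Lambda> \<omega>"
    by (rule unital_bounded_algebra.inverse_closed_if_norm_equivalent
        [OF unital_bounded_algebra_bcmat assms norm_equivalent_bcmat_norm])
  show "inverse_closed hmat_mult (hmat_one :: (real^4)^'n^'n) hmat_norm \<Lambda> \<omega>"
    by (rule unital_bounded_algebra.inverse_closed_if_norm_equivalent
        [OF unital_bounded_algebra_hmat assms norm_equivalent_hmat_norm])
qed

end
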